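(* Let $p_a,p_b,p_c$ be nonnegative numbers summing to $1$, let $\alpha=r/s$ and $\beta=q/s$ with $r,q\in\mathbb N_0$ and $s\in\mathbb N$, and let $(X_t)_{t\in\mathbb N}$ be a sequence of $\mathbb N$-valued random variables. Let $(G_t)_{t\ge0}$ be the growing directed graph generated by the generalized directed scale-free graph model with these parameters (defined in the context). Suppose that $\ell=\ell(n)$ and $u=u(n)$ are positive integers such that $\ell\le X_t\le u$ for all $t\in\mathbb N$. Then there is a constant $C$, not depending on $n$, such that asymptotically almost surely (as $n\to\infty$) the diameter of $G_n$ is at most $$\frac{4e(u+\alpha+\beta)\log n}{\ell}+C\,u.$$
   Context: Conventions: $\mathbb N=\{1,2,\dots\}$, $\mathbb N_0=\{0,1,2,\dots\}$; $\log$ is the natural logarithm and $e$ its base. Graphs are finite and may have loops and parallel edges. Distance between two vertices of a directed graph is the number of edges in a shortest path ignoring edge directions; the diameter is the maximum distance between two vertices. The initial graph $G_0$ is finite of size $O(1)$ (bounded independently of $n$). "Asymptotically almost surely" means with probability tending to $1$ as $n\to\infty$. Random choices at time $t$ have the stated distributions conditionally on the history of the process up to time $t-1$ and on the value $X_t$. For a directed graph $G$ and a real number $\delta\ge0$, define for $v\in V(G)$ $$\rho^{out}_\delta(v)=\frac{\operatorname{out-deg}(v)+\delta}{\sum_{u\in V(G)}(\operatorname{out-deg}(u)+\delta)},\qquad \rho^{in}_\delta(v)=\frac{\operatorname{in-deg}(v)+\delta}{\sum_{u\in V(G)}(\operatorname{in-deg}(u)+\delta)}.$$ Model: $G_0$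 is an arbitrary weakly connected directed graph (such that the distributions used below are well defined, i.e. have positive denominators; this is automatic if $G_0$ has at least one edge). At each time-step $t\in\mathbb N$, exactly one of the following three operations is performed on $G_{t-1}$ to obtain $G_t$, with probabilities $p_a,p_b,p_c$ respectively. (a) Sample $X_t$ vertices of $G_{t-1}$ independently using $\rho^{in}_\alpha$; then add a new vertex and join it to the sampled vertices (edges directed from the new vertex to the sampled vertices). (b) Sample $X_t$ vertices of $G_{t-1}$ independently using $\rho^{out}_\beta$; then add a new vertex and join the sampled vertices to it (edges directed from the sampled vertices to the new vertex). (c) Sample $X_t$ vertices $w_1,\dots,w_{X_t}$ of $G_{t-1}$ independently using $\rho^{out}_\beta$ and $X_t$ vertices $w_1',\dots,w_{X_t}'$ of $G_{t-1}$ independently using $\rho^{in}_\alpha$; then add the directed edges $w_1w_1',\dots,w_{X_t}w_{X_t}'$. *)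

theory Defs
  imports "HOL-Probability.Probability" "Graph_Theory.Graph_Theory"
begin

text \<open>
  Directed multigraphs (loops and parallel edges allowed) are the \<^type>\<open>pre_digraph\<close>s of
  the entry Graph Theory; vertices and edges are labelled by natural numbers.
\<close>

type_synonym multigraph = "(nat, nat) pre_digraph"

text \<open>
  Distances ignore edge directions: they are unit-weight shortest-path distances in the
  symmetric closure, with value \<open>\<infinity>\<close> if there is no path.
\<close>

definition undirected_dist :: "multigraph \<Rightarrow> nat \<Rightarrow> nat \<Rightarrow> ereal" where
  "undirected_dist G v w = wf_digraph.\<mu> (with_proj (mk_symmetric G)) (\<lambda>_. 1) v w"

definition undirected_diameter :: "multigraph \<Rightarrow> ereal" where
  "undirected_diameter G = (SUP v\<in>verts G. SUP w\<in>verts G. undirected_dist G v w)"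

text \<open>Both sampling distributions are supported on the vertex set.\<close>

definition rho_out :: "real \<Rightarrow> multigraph \<Rightarrow> nat \<Rightarrow> real" where
  "rho_out \<delta> G v = (if v \<in> verts G
     then (real (out_degree G v) + \<delta>) / (\<Sum>w\<in>verts G. real (out_degree G w) + \<delta>) else 0)"

definition rho_in :: "real \<Rightarrow> multigraph \<Rightarrow> nat \<Rightarrow> real" where
  "rho_in \<delta> G v = (if v \<in> verts G
     then (real (in_degree G v) + \<delta>) / (\<Sum>w\<in>verts G. real (in_degree G w) + \<delta>) else 0)"

text \<open>For a finite set of labels in use, all labels from \<open>fresh_label A\<close> on are unused.\<close>

definition fresh_label :: "nat set \<Rightarrow> nat" where
  "fresh_label A = (LEAST k. A \<subseteq> {..<k})"

definition add_edge :: "nat \<times> nat \<Rightarrow> multigraph \<Rightarrow> multigraph" where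
  "add_edge e G = (let a = fresh_label (arcs G) in
     G\<lparr>arcs := insert a (arcs G), tail := (tail G)(a := fst e), head := (head G)(a := snd e)\<rparr>)"

text \<open>
  The random choices of one time-step: which operation is performed, together with the ordered
  sample(s) of vertices. In \<open>Op_c vs ws\<close> the list \<open>vs\<close> is the sample of tails and \<open>ws\<close> the sample
  of heads.
\<close>

datatype choice = Op_a "nat list" | Op_b "nat list" | Op_c "nat list" "nat list"

fun perform :: "choice \<Rightarrow> multigraph \<Rightarrow> multigraph" where
  "perform (Op_a ws) G = (let v = fresh_label (verts G) in
     fold add_edge (map (\<lambda>w. (v, w)) ws) (G\<lparr>verts := insert v (verts G)\<rparr>))"
| "perform (Op_b ws) G = (let v = fresh_label (verts G) in
     fold add_edge (map (\<lambda>w. (w, v)) ws) (G\<lparr>verts := insert v (verts G)\<rparr>))"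
| "perform (Op_c vs ws) G = fold add_edge (zip vs ws) G"

text \<open>\<open>grow G\<^sub>0 c t\<close> is the graph after the choices \<open>c 1, \<dots>, c t\<close>; \<open>c 0\<close> is irrelevant.\<close>

primrec grow :: "multigraph \<Rightarrow> (nat \<Rightarrow> choice) \<Rightarrow> nat \<Rightarrow> multigraph" where
  "grow G\<^sub>0 c 0 = G\<^sub>0"
| "grow G\<^sub>0 c (Suc t) = perform (c (Suc t)) (grow G\<^sub>0 c t)"

text \<open>
  The probability of each choice when the current graph is \<open>G\<close> and \<open>x\<close> vertices are to be
  sampled: the products express the independence of the samples.
\<close>

fun choice_prob ::
  "real \<Rightarrow> real \<Rightarrow> real \<Rightarrow> real \<Rightarrow> real \<Rightarrow> multigraph \<Rightarrow> nat \<Rightarrow> choice \<Rightarrow> real" where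
  "choice_prob p\<^sub>a p\<^sub>b p\<^sub>c \<alpha> \<beta> G x (Op_a ws) =
     (if length ws = x then p\<^sub>a * (\<Prod>w\<leftarrow>ws. rho_in \<alpha> G w) else 0)"
| "choice_prob p\<^sub>a p\<^sub>b p\<^sub>c \<alpha> \<beta> G x (Op_b ws) =
     (if length ws = x then p\<^sub>b * (\<Prod>w\<leftarrow>ws. rho_out \<beta> G w) else 0)"
| "choice_prob p\<^sub>a p\<^sub>b p\<^sub>c \<alpha> \<beta> G x (Op_c vs ws) =
     (if length vs = x \<and> length ws = x
      then p\<^sub>c * (\<Prod>v\<leftarrow>vs. rho_out \<beta> G v) * (\<Prod>w\<leftarrow>ws. rho_in \<alpha> G w) else 0)"

text \<open>
  The graph process is determined by \<open>G\<^sub>0\<close> and the random choices \<open>c\<close>. The joint law of the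
  sample sizes \<open>X\<close> is arbitrary, and \<open>X t\<close> may depend on the past; only the law of the choices at
  time \<open>t\<close> given the history up to time \<open>t - 1\<close> and given \<open>X t\<close> is prescribed. All variables are
  discrete, so elementary conditional probabilities suffice. The denominator of a sampling
  distribution has to be positive only if that distribution is used with positive probability.
\<close>

locale directed_scale_free = prob_space M for M :: "'w measure" +
  fixes p\<^sub>a p\<^sub>b p\<^sub>c \<alpha> \<beta> :: real
    and G\<^sub>0 :: multigraph
    and X :: "nat \<Rightarrow> 'w \<Rightarrow> nat"
    and c :: "nat \<Rightarrow> 'w \<Rightarrow> choice"
  assumes finite_initial: "fin_digraph G\<^sub>0"
    and weakly_connected_initial: "Digraph_Component.connected G\<^sub>0"
    and in_denominator_pos:
      "p\<^sub>a > 0 \<or> p\<^sub>c > 0 \<Longrightarrow> (\<Sum>v\<in>verts G\<^sub>0. real (in_degree G\<^sub>0 v) + \<alpha>) > 0"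
    and out_denominator_pos:
      "p\<^sub>b > 0 \<or> p\<^sub>c > 0 \<Longrightarrow> (\<Sum>v\<in>verts G\<^sub>0. real (out_degree G\<^sub>0 v) + \<beta>) > 0"
    and X_measurable: "t \<ge> 1 \<Longrightarrow> X t \<in> measurable M (count_space UNIV)"
    and c_measurable: "t \<ge> 1 \<Longrightarrow> c t \<in> measurable M (count_space UNIV)"
    and choice_law:
      "\<lbrakk>t \<ge> 1; \<P>(\<omega> in M. (\<forall>i\<in>{1..<t}. X i \<omega> = x i \<and> c i \<omega> = d i) \<and> X t \<omega> = x t) > 0\<rbrakk> \<Longrightarrow>
       \<P>(\<omega> in M. c t \<omega> = d t \<bar> (\<forall>i\<in>{1..<t}. X i \<omega> = x i \<and> c i \<omega> = d i) \<and> X t \<omega> = x t)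
         = choice_prob p\<^sub>a p\<^sub>b p\<^sub>c \<alpha> \<beta> (grow G\<^sub>0 d (t - 1)) (x t) (d t)"

end

theory Submission
  imports Defs
begin

text \<open>
  Give the initial vertices depth \<open>0\<close> and a new vertex depth one more than the first vertex sampled
  for it; the depth bounds the distance to the initial graph. Weight each incidence of an
  edge with a vertex by \<open>1\<close> and each vertex additionally by \<open>\<alpha> + \<beta>\<close>, and let \<open>W\<^sub>t\<close> be the sum of the
  weights times \<open>exp depth\<close>. Since a sampled vertex has expected \<open>exp depth\<close> at most \<open>W\<^sub>t\<close> divided by
  \<open>l t\<close>, one step multiplies the expectation of \<open>W\<^sub>t\<close> by at most
  \<open>1 + (u + e (u + \<alpha> + \<beta>)) / (l t)\<close>. Hence \<open>W\<^sub>n\<close> has expectation at most \<open>exp (O(u))\<close> times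
  \<open>n\<close> to the power \<open>(1 + e) (u + \<alpha> + \<beta>) / l\<close>, and as \<open>1 + e < 2 e\<close>, by Markov's inequality no vertex
  is deeper than \<open>2 e (u + \<alpha> + \<beta>) log n / l + O(u)\<close>, with probability \<open>1 - O(1/n)\<close>.
\<close>

subsection \<open>Adding edges and walks\<close>

lemma fresh_label_notin:
  assumes "finite A"
  shows "fresh_label A \<notin> A"
proof -
  obtain k where "A \<subseteq> {..<k}"
    using assms finite_nat_iff_bounded by blast
  then have "A \<subseteq> {..<fresh_label A}"
    unfolding fresh_label_def by (rule LeastI)
  then show ?thesis by auto
qed

lemma verts_add_edge [simp]: "verts (add_edge e G) = verts G"
  by (simp add: add_edge_def Let_def)

lemma verts_fold_add_edge [simp]: "verts (fold add_edge es G) = verts G"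
  by (induction es arbitrary: G) auto

lemma arcs_add_edge [simp]: "arcs (add_edge e G) = insert (fresh_label (arcs G)) (arcs G)"
  by (simp add: add_edge_def Let_def)

lemma sum_arcs_add_edge:
  fixes g :: "nat \<Rightarrow> nat \<Rightarrow> 'a::comm_monoid_add"
  assumes "finite (arcs G)"
  shows "(\<Sum>a\<in>arcs (add_edge e G). g (tail (add_edge e G) a) (head (add_edge e G) a))
    = g (fst e) (snd e) + (\<Sum>a\<in>arcs G. g (tail G a) (head G a))"
proof -
  have "fresh_label (arcs G) \<notin> arcs G"
    using assms by (rule fresh_label_notin)
  then show ?thesis
    using assms by (auto simp: add_edge_def Let_def intro!: sum.cong arg_cong2[where f="(+)"])
qed

lemma finite_arcs_fold_add_edge:
  "finite (arcs G) \<Longrightarrow> finite (arcs (fold add_edge es G))"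
  by (induction es arbitrary: G) auto

lemma sum_arcs_fold_add_edge:
  fixes g :: "nat \<Rightarrow> nat \<Rightarrow> 'a::comm_monoid_add"
  assumes "finite (arcs G)"
  shows "(\<Sum>a\<in>arcs (fold add_edge es G). g (tail (fold add_edge es G) a) (head (fold add_edge es G) a))
    = (\<Sum>e\<leftarrow>es. g (fst e) (snd e)) + (\<Sum>a\<in>arcs G. g (tail G a) (head G a))"
  using assms
proof (induction es arbitrary: G)
  case (Cons e es)
  have "finite (arcs (add_edge e G))"
    using Cons.prems by simp
  from Cons.IH[OF this] show ?case
    using Cons.prems by (simp add: sum_arcs_add_edge ac_simps del: arcs_add_edge)
qed simp

lemma card_arcs_fold_add_edge:
  "finite (arcs G) \<Longrightarrow> card (arcs (fold add_edge es G)) = length es + card (arcs G)"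
  by (induction es arbitrary: G) (auto simp: fresh_label_notin)

lemma arcs_ends_add_edge:
  assumes "finite (arcs G)"
  shows "arcs_ends (add_edge e G) = insert e (arcs_ends G)"
proof -
  have "fresh_label (arcs G) \<notin> arcs G"
    using assms by (rule fresh_label_notin)
  then show ?thesis
    by (force simp: arcs_ends_def arc_to_ends_def add_edge_def Let_def)
qed

lemma arcs_ends_fold_add_edge:
  "finite (arcs G) \<Longrightarrow> arcs_ends (fold add_edge es G) = set es \<union> arcs_ends G"
  by (induction es arbitrary: G) (auto simp: arcs_ends_add_edge)

section \<open>Walks that ignore edge directions\<close>

definition adjacent :: "multigraph \<Rightarrow> (nat \<times> nat) set" where
  "adjacent G = arcs_ends G \<union> (arcs_ends G)\<inverse>"

text \<open>Links the symmetric closure, through which distances are defined, to a plain relation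
  whose powers describe walks of a given length.\<close>

lemma adjacent_eq: "adjacent G = parcs (mk_symmetric G)"
  by (auto simp: adjacent_def parcs_mk_symmetric arcs_ends_conv)

lemma adjacent_mono: "arcs_ends G \<subseteq> arcs_ends H \<Longrightarrow> adjacent G \<subseteq> adjacent H"
  by (auto simp: adjacent_def)

lemma relpow_adjacent_sym: "(v, w) \<in> adjacent G ^^ k \<Longrightarrow> (w, v) \<in> adjacent G ^^ k"
proof (induction k arbitrary: v)
  case (Suc k)
  then obtain y where "(v, y) \<in> adjacent G" "(y, w) \<in> adjacent G ^^ k"
    by (meson relpow_Suc_D2)
  then have "(w, y) \<in> adjacent G ^^ k" "(y, v) \<in> adjacent G"
    using Suc.IH by (auto simp: adjacent_def)
  then show ?case by auto
qed simp

text \<open>A \<open>k\<close>-fold composition unfolds to an arc walk of length \<open>k\<close>;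
  with unit costs it costs \<open>k\<close>, and the distance is the infimum of such costs.\<close>

lemma undirected_dist_le:
  assumes "wf_digraph G" "v \<in> verts G" "(v, w) \<in> adjacent G ^^ k"
  shows "undirected_dist G v w \<le> ereal (real k)"
proof -
  let ?S = "with_proj (mk_symmetric G)"
  interpret G: wf_digraph G by fact
  interpret S: pair_wf_digraph "mk_symmetric G" ..
  have wf: "wf_digraph ?S" ..
  have "\<exists>p. S.awalk v p w \<and> length p = k"
    using assms(2,3)
  proof (induction k arbitrary: v)
    case 0
    then show ?case by (auto simp: S.awalk_def S.cas.simps)
  next
    case (Suc k)
    then obtain y where y: "(v, y) \<in> adjacent G" "(y, w) \<in> adjacent G ^^ k"
      by (meson relpow_Suc_D2)
    then have "y \<in> verts G"
      using S.in_arcsD2 by (fastforce simp: adjacent_eq)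
    with y Suc.IH obtain p where "S.awalk y p w" "length p = k" by blast
    then have "S.awalk v ((v, y) # p) w \<and> length ((v, y) # p) = Suc k"
      using y Suc.prems by (auto simp: S.awalk_def S.cas.simps adjacent_eq)
    then show ?case by blast
  qed
  then obtain p where p: "S.awalk v p w" "length p = k" by blast
  have "undirected_dist G v w \<le> ereal (S.awalk_cost (\<lambda>_. 1) p)"
    unfolding undirected_dist_def wf_digraph.\<mu>_def[OF wf] using p(1)
    by (intro INF_lower2[of p]) auto
  also have "S.awalk_cost (\<lambda>_. 1) p = real k"
    using p(2) by (simp add: S.awalk_cost_def sum_list_triv)
  finally show ?thesis .
qed

text \<open>Reachability in a finite relation needs at most as many steps as the relation has pairs,
  and each arc yields at most two pairs. This crude bound controls the diameter of the initial graph
  by its size.\<close>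

lemma connected_relpow_adjacent:
  assumes "fin_digraph G" "Digraph_Component.connected G" "v \<in> verts G" "w \<in> verts G"
  obtains k where "k \<le> 2 * card (arcs G)" "(v, w) \<in> adjacent G ^^ k"
proof -
  interpret fin_digraph G by fact
  have ends: "finite (arcs_ends G)" "card (arcs_ends G) \<le> card (arcs G)"
    by (auto simp: arcs_ends_def card_image_le)
  have fin: "finite (adjacent G)"
    using ends by (simp add: adjacent_def)
  have "card (adjacent G) \<le> card (arcs_ends G) + card ((arcs_ends G)\<inverse>)"
    unfolding adjacent_def by (rule card_Un_le)
  also have "card ((arcs_ends G)\<inverse>) = card (arcs_ends G)"
    by (rule card_inverse)
  finally have card: "card (adjacent G) \<le> 2 * card (arcs G)"
    using ends by simp
  have "(v, w) \<in> rtrancl_on (verts G) (adjacent G)"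
    using assms(2-4)
    by (auto simp: connected_def strongly_connected_def reachable_def adjacent_eq)
  then have "(v, w) \<in> (adjacent G)\<^sup>*"
    by (rule rtrancl_on_rtranclI)
  then show thesis
    using that fin card by (auto simp: rtrancl_finite_eq_relpow dest: order_trans)
qed

subsection \<open>Expected sums over samples\<close>

text \<open>Double counting: group the arcs by their head or by their tail.\<close>

lemma sum_degree_weighted:
  fixes f :: "nat \<Rightarrow> real"
  assumes "fin_digraph G"
  shows "(\<Sum>v\<in>verts G. real (in_degree G v) * f v) = (\<Sum>a\<in>arcs G. f (head G a))"
    and "(\<Sum>v\<in>verts G. real (out_degree G v) * f v) = (\<Sum>a\<in>arcs G. f (tail G a))"
proof -
  interpret fin_digraph G by fact
  have "(\<Sum>v\<in>verts G. real (in_degree G v) * f v)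
      = (\<Sum>v\<in>verts G. \<Sum>a\<in>{a \<in> arcs G. head G a = v}. f (head G a))"
    by (intro sum.cong) (auto simp: in_degree_def in_arcs_def)
  also have "\<dots> = (\<Sum>a\<in>arcs G. f (head G a))"
    by (intro sum.group) auto
  finally show "(\<Sum>v\<in>verts G. real (in_degree G v) * f v) = (\<Sum>a\<in>arcs G. f (head G a))" .
  have "(\<Sum>v\<in>verts G. real (out_degree G v) * f v)
      = (\<Sum>v\<in>verts G. \<Sum>a\<in>{a \<in> arcs G. tail G a = v}. f (tail G a))"
    by (intro sum.cong) (auto simp: out_degree_def out_arcs_def)
  also have "\<dots> = (\<Sum>a\<in>arcs G. f (tail G a))"
    by (intro sum.group) auto
  finally show "(\<Sum>v\<in>verts G. real (out_degree G v) * f v) = (\<Sum>a\<in>arcs G. f (tail G a))" .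
qed

text \<open>The case \<open>f = 1\<close> of \<open>sum_degree_weighted\<close> evaluates the
  denominators, which therefore agree for both distributions. If they vanish, both sides are
  \<open>0\<close>.\<close>

lemma sum_rho_weighted:
  fixes f :: "nat \<Rightarrow> real"
  assumes "fin_digraph G"
  shows "(\<Sum>v\<in>verts G. rho_in \<delta> G v * f v)
      = ((\<Sum>a\<in>arcs G. f (head G a)) + \<delta> * sum f (verts G))
        / (real (card (arcs G)) + \<delta> * real (card (verts G)))"
    and "(\<Sum>v\<in>verts G. rho_out \<delta> G v * f v)
      = ((\<Sum>a\<in>arcs G. f (tail G a)) + \<delta> * sum f (verts G))
        / (real (card (arcs G)) + \<delta> * real (card (verts G)))"
  using sum_degree_weighted[OF assms, of f] sum_degree_weighted[OF assms, of "\<lambda>_. 1"]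
  by (simp_all add: rho_in_def rho_out_def sum.distrib algebra_simps sum_distrib_left
      sum_divide_distrib[symmetric])

lemma rho_nonneg: "\<delta> \<ge> 0 \<Longrightarrow> rho_in \<delta> G v \<ge> 0" "\<delta> \<ge> 0 \<Longrightarrow> rho_out \<delta> G v \<ge> 0"
  by (auto simp: rho_in_def rho_out_def intro!: divide_nonneg_nonneg sum_nonneg)

text \<open>The sums are \<open>0\<close> rather than \<open>1\<close> if the normalising denominator vanishes.\<close>

lemma sum_rho_le_1:
  assumes "fin_digraph G"
  shows "sum (rho_in \<delta> G) (verts G) \<le> 1" "sum (rho_out \<delta> G) (verts G) \<le> 1"
  using sum_rho_weighted[OF assms, of \<delta> "\<lambda>_. 1"] by simp_all

text \<open>On a finite digraph this sums \<open>f v\<close> times the total degree plus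
  \<open>\<gamma>\<close>. Counting both ends of each arc lets one quantity dominate the
  unnormalised sums of both distributions; it is used with
  \<open>\<gamma> = \<alpha> + \<beta>\<close>.\<close>

definition weight :: "real \<Rightarrow> (nat \<Rightarrow> real) \<Rightarrow> multigraph \<Rightarrow> real" where
  "weight \<gamma> f G = (\<Sum>a\<in>arcs G. f (tail G a) + f (head G a)) + \<gamma> * sum f (verts G)"

lemma weight_nonneg: "(\<And>v. f v \<ge> 0) \<Longrightarrow> \<gamma> \<ge> 0 \<Longrightarrow> weight \<gamma> f G \<ge> 0"
  by (auto simp: weight_def intro!: add_nonneg_nonneg sum_nonneg mult_nonneg_nonneg)

lemma weight_cong:
  assumes "wf_digraph G" "\<And>v. v \<in> verts G \<Longrightarrow> f v = g v"
  shows "weight \<gamma> f G = weight \<gamma> g G"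
  using assms by (simp add: weight_def wf_digraph.tail_in_verts wf_digraph.head_in_verts)

lemma weight_insert_vertex:
  assumes "finite (verts G)" "v \<notin> verts G"
  shows "weight \<gamma> f (G\<lparr>verts := insert v (verts G)\<rparr>) = weight \<gamma> f G + \<gamma> * f v"
  using assms by (simp add: weight_def algebra_simps)

lemma weight_fold_add_edge:
  assumes "finite (arcs G)"
  shows "weight \<gamma> f (fold add_edge es G) = weight \<gamma> f G + (\<Sum>e\<leftarrow>es. f (fst e) + f (snd e))"
  using sum_arcs_fold_add_edge[OF assms, where g="\<lambda>x y. f x + f y" and es=es]
  by (simp add: weight_def)

text \<open>The numerators in \<open>sum_rho_weighted\<close> count one end of each arc and at most
  \<open>\<gamma>\<close> for each vertex. Bounding the reciprocal instead of the denominator also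
  covers a vanishing denominator, as \<open>inverse 0 = 0\<close>.\<close>

lemma sum_rho_le_weight:
  assumes "fin_digraph G" "\<And>v. f v \<ge> 0" "0 \<le> \<delta>" "\<delta> \<le> \<gamma>"
    and z: "inverse (real (card (arcs G)) + \<delta> * real (card (verts G))) \<le> z"
  shows "(\<Sum>v\<in>verts G. rho_in \<delta> G v * f v) \<le> weight \<gamma> f G * z"
    and "(\<Sum>v\<in>verts G. rho_out \<delta> G v * f v) \<le> weight \<gamma> f G * z"
proof -
  let ?Z = "real (card (arcs G)) + \<delta> * real (card (verts G))"
  have sums: "0 \<le> (\<Sum>a\<in>arcs G. f (head G a))" "0 \<le> (\<Sum>a\<in>arcs G. f (tail G a))"
    "0 \<le> sum f (verts G)"
    using assms(2) by (auto intro: sum_nonneg)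
  have vs: "\<delta> * sum f (verts G) \<le> \<gamma> * sum f (verts G)" "0 \<le> \<delta> * sum f (verts G)"
    using sums assms(3,4) by (auto intro: mult_right_mono)
  have "0 \<le> inverse ?Z"
    using assms(3) by simp
  then show "(\<Sum>v\<in>verts G. rho_in \<delta> G v * f v) \<le> weight \<gamma> f G * z"
    "(\<Sum>v\<in>verts G. rho_out \<delta> G v * f v) \<le> weight \<gamma> f G * z"
    unfolding sum_rho_weighted[OF assms(1)] divide_inverse
    by (intro mult_mono[OF _ z]; use sums vs in \<open>simp add: weight_def sum.distrib\<close>)+
qed

section \<open>Expectations over independent draws\<close>

lemma sum_lists_Suc:
  fixes g :: "'a list \<Rightarrow> real"
  assumes "finite A"
  shows "(\<Sum>xs\<in>{xs. set xs \<subseteq> A \<and> length xs = Suc k}. g xs)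
    = (\<Sum>a\<in>A. \<Sum>xs\<in>{xs. set xs \<subseteq> A \<and> length xs = k}. g (a # xs))"
proof -
  have "(\<Sum>xs\<in>{xs. set xs \<subseteq> A \<and> length xs = Suc k}. g xs)
      = (\<Sum>(xs, a)\<in>{xs. set xs \<subseteq> A \<and> length xs = k} \<times> A. g (a # xs))"
    unfolding lists_length_Suc_eq
    by (subst sum.reindex) (auto simp: inj_on_def case_prod_unfold intro!: sum.cong)
  also have "\<dots> = (\<Sum>xs\<in>{xs. set xs \<subseteq> A \<and> length xs = k}. \<Sum>a\<in>A. g (a # xs))"
    by (rule sum.cartesian_product[symmetric])
  finally show ?thesis
    by (simp add: sum.swap[of _ A])
qed

text \<open>The mass may be below \<open>1\<close> because a sampling distribution with vanishing
  denominator is identically zero.\<close>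

locale subprobability_on =
  fixes A :: "'a set" and \<rho> :: "'a \<Rightarrow> real"
  assumes fin: "finite A" and nonneg: "\<And>a. \<rho> a \<ge> 0" and le1: "sum \<rho> A \<le> 1"
begin

text \<open>Expectation of \<open>g\<close> over an ordered list of \<open>k\<close> independent
  draws, without rescaling if the mass is below \<open>1\<close>.\<close>

definition sampled :: "nat \<Rightarrow> ('a list \<Rightarrow> real) \<Rightarrow> real" where
  "sampled k g = (\<Sum>xs\<in>{xs. set xs \<subseteq> A \<and> length xs = k}. (\<Prod>x\<leftarrow>xs. \<rho> x) * g xs)"

lemma prod_list_\<rho>_nonneg: "(\<Prod>x\<leftarrow>xs. \<rho> x) \<ge> 0"
  by (induction xs) (simp_all add: nonneg)

lemma sampled_Suc: "sampled (Suc k) g = (\<Sum>a\<in>A. \<rho> a * sampled k (\<lambda>xs. g (a # xs)))"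
  unfolding sampled_def sum_lists_Suc[OF fin] by (simp add: sum_distrib_left mult_ac)

lemma sampled_0: "sampled 0 g = g []"
proof -
  have "{xs. set xs \<subseteq> A \<and> length xs = 0} = {[]}" by auto
  then show ?thesis by (simp add: sampled_def)
qed

lemma sampled_mono:
  "(\<And>xs. set xs \<subseteq> A \<Longrightarrow> length xs = k \<Longrightarrow> g xs \<le> h xs) \<Longrightarrow> sampled k g \<le> sampled k h"
  unfolding sampled_def by (intro sum_mono mult_left_mono prod_list_\<rho>_nonneg) auto

lemma sampled_add: "sampled k (\<lambda>xs. g xs + h xs) = sampled k g + sampled k h"
  by (simp add: sampled_def distrib_left sum.distrib)

lemma sampled_cmult: "sampled k (\<lambda>xs. c * g xs) = c * sampled k g"
  by (simp add: sampled_def sum_distrib_left mult_ac)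

lemma sampled_const: "sampled k (\<lambda>_. c) = c * sum \<rho> A ^ k"
proof (induction k)
  case (Suc k)
  then show ?case by (simp add: sampled_Suc sum_distrib_right[symmetric] sum_distrib_left[symmetric] mult_ac)
qed (simp add: sampled_0)

lemma sampled_const_le: "c \<ge> 0 \<Longrightarrow> sampled k (\<lambda>_. c) \<le> c"
  using le1 nonneg by (simp add: sampled_const mult_left_le power_le_one sum_nonneg)

text \<open>Linearity of expectation, one draw at a time. As \<open>B\<close> is nonnegative, the
  mass of the other draws may be raised to \<open>1\<close>.\<close>

lemma sampled_sum_list_le:
  assumes f: "\<And>a. f a \<ge> 0" and B: "(\<Sum>a\<in>A. \<rho> a * f a) \<le> B"
  shows "sampled k (\<lambda>xs. \<Sum>x\<leftarrow>xs. f x) \<le> real k * B"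
proof (induction k)
  case (Suc k)
  have "0 \<le> (\<Sum>a\<in>A. \<rho> a * f a)"
    using f nonneg by (intro sum_nonneg) auto
  then have "0 \<le> B" using B by simp
  have "sampled (Suc k) (\<lambda>xs. \<Sum>x\<leftarrow>xs. f x)
      = (\<Sum>a\<in>A. \<rho> a * (sampled k (\<lambda>_. f a) + sampled k (\<lambda>xs. \<Sum>x\<leftarrow>xs. f x)))"
    by (simp add: sampled_Suc sampled_add)
  also have "\<dots> \<le> (\<Sum>a\<in>A. \<rho> a * (f a + real k * B))"
    by (intro sum_mono mult_left_mono add_mono sampled_const_le f Suc nonneg)
  also have "\<dots> = (\<Sum>a\<in>A. \<rho> a * f a) + sum \<rho> A * (real k * B)"
    by (simp add: distrib_left sum.distrib sum_distrib_right)
  also have "\<dots> \<le> B + 1 * (real k * B)"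
    using B le1 \<open>0 \<le> B\<close> by (intro add_mono mult_right_mono) auto
  finally show ?case by (simp add: algebra_simps)
qed (simp add: sampled_0)

text \<open>The first entry behaves like a single draw, since the remaining draws have mass at most
  \<open>1\<close>. This is why depths refer to the first sampled vertex.\<close>

lemma sampled_hd_le:
  assumes f: "\<And>a. f a \<ge> 0" and B: "(\<Sum>a\<in>A. \<rho> a * f a) \<le> B" and "k \<ge> 1"
  shows "sampled k (\<lambda>xs. f (hd xs)) \<le> B"
proof -
  obtain j where k: "k = Suc j"
    using \<open>k \<ge> 1\<close> by (cases k) auto
  have "sampled k (\<lambda>xs. f (hd xs)) \<le> (\<Sum>a\<in>A. \<rho> a * f a)"
    unfolding k sampled_Suc by (intro sum_mono mult_left_mono) (simp_all add: sampled_const_le f nonneg)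
  then show ?thesis using B by simp
qed

text \<open>The shape of the weight after one step: the old weight, one incidence for each sampled
  vertex, and the share of a new vertex. Operation (c) uses \<open>\<kappa> = 0\<close>.\<close>

lemma sampled_le:
  assumes "\<And>a. f a \<ge> 0" "(\<Sum>a\<in>A. \<rho> a * f a) \<le> B" "k \<ge> 1" "w \<ge> 0" "\<kappa> \<ge> 0"
  shows "sampled k (\<lambda>xs. w + (\<Sum>x\<leftarrow>xs. f x) + \<kappa> * f (hd xs)) \<le> w + real k * B + \<kappa> * B"
  using sampled_sum_list_le[OF assms(1,2), of k] sampled_hd_le[OF assms(1,2,3)]
    sampled_const_le[OF assms(4), of k] mult_left_mono[OF _ assms(5)]
  unfolding sampled_add sampled_cmult by (meson add_mono)

end

section \<open>Depth update and admissible choices\<close>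

fun perform_depth :: "choice \<Rightarrow> multigraph \<Rightarrow> (nat \<Rightarrow> nat) \<Rightarrow> nat \<Rightarrow> nat" where
  "perform_depth (Op_a ws) G D = D(fresh_label (verts G) := Suc (D (hd ws)))"
| "perform_depth (Op_b ws) G D = D(fresh_label (verts G) := Suc (D (hd ws)))"
| "perform_depth (Op_c vs ws) G D = D"

text \<open>A finite set of choices that contains the support of \<open>choice_prob\<close>, so that
  sums over all choices become finite.\<close>

fun admissible :: "nat \<Rightarrow> multigraph \<Rightarrow> choice \<Rightarrow> bool" where
  "admissible x G (Op_a ws) \<longleftrightarrow> set ws \<subseteq> verts G \<and> length ws = x"
| "admissible x G (Op_b ws) \<longleftrightarrow> set ws \<subseteq> verts G \<and> length ws = x"
| "admissible x G (Op_c vs ws) \<longleftrightarrow>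
     (set vs \<subseteq> verts G \<and> length vs = x) \<and> set ws \<subseteq> verts G \<and> length ws = x"

lemma prod_list_map_eq_0:
  fixes \<rho> :: "'a \<Rightarrow> real"
  shows "(\<forall>a. a \<notin> A \<longrightarrow> \<rho> a = 0) \<Longrightarrow> \<not> set xs \<subseteq> A \<Longrightarrow> (\<Prod>x\<leftarrow>xs. \<rho> x) = 0"
  by (induction xs) auto

lemma choice_prob_not_admissible:
  assumes "\<not> admissible x G d"
  shows "choice_prob p\<^sub>a p\<^sub>b p\<^sub>c \<alpha> \<beta> G x d = 0"
proof -
  have "(\<Prod>w\<leftarrow>ws. rho_in \<alpha> G w) = 0" "(\<Prod>w\<leftarrow>ws. rho_out \<beta> G w) = 0"
    if "\<not> set ws \<subseteq> verts G" for ws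
    using that by (auto intro!: prod_list_map_eq_0[of "verts G"] simp: rho_in_def rho_out_def)
  then show ?thesis
    using assms by (cases d) (simp_all, blast+)
qed

lemma Collect_admissible:
  fixes x G
  defines "S \<equiv> {ws. set ws \<subseteq> verts G \<and> length ws = x}"
  shows "{d. admissible x G d} = Op_a ` S \<union> Op_b ` S \<union> (\<lambda>(vs, ws). Op_c vs ws) ` (S \<times> S)"
proof (intro set_eqI)
  fix d show "d \<in> {d. admissible x G d} \<longleftrightarrow>
      d \<in> Op_a ` S \<union> Op_b ` S \<union> (\<lambda>(vs, ws). Op_c vs ws) ` (S \<times> S)"
    by (cases d) (auto simp: S_def)
qed

lemma finite_admissible: "finite (verts G) \<Longrightarrow> finite {d. admissible x G d}"
  unfolding Collect_admissible by (auto simp: finite_lists_length_eq)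

lemma sum_admissible:
  fixes x G and g :: "choice \<Rightarrow> real"
  defines "S \<equiv> {ws. set ws \<subseteq> verts G \<and> length ws = x}"
  assumes "finite (verts G)"
  shows "(\<Sum>d | admissible x G d. g d)
    = (\<Sum>ws\<in>S. g (Op_a ws)) + (\<Sum>ws\<in>S. g (Op_b ws)) + (\<Sum>vs\<in>S. \<Sum>ws\<in>S. g (Op_c vs ws))"
proof -
  have fin: "finite S"
    unfolding S_def using assms(2) by (rule finite_lists_length_eq)
  have a: "sum g (Op_a ` S) = (\<Sum>ws\<in>S. g (Op_a ws))"
    and b: "sum g (Op_b ` S) = (\<Sum>ws\<in>S. g (Op_b ws))"
    by (subst sum.reindex; auto simp: inj_on_def)+
  have c: "sum g ((\<lambda>(vs, ws). Op_c vs ws) ` (S \<times> S)) = (\<Sum>vs\<in>S. \<Sum>ws\<in>S. g (Op_c vs ws))"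
    by (subst sum.reindex) (auto simp: inj_on_def sum.cartesian_product intro!: sum.cong)
  have "sum g (Op_a ` S \<union> Op_b ` S \<union> (\<lambda>(vs, ws). Op_c vs ws) ` (S \<times> S))
     = sum g (Op_a ` S \<union> Op_b ` S) + sum g ((\<lambda>(vs, ws). Op_c vs ws) ` (S \<times> S))"
    using fin by (intro sum.union_disjoint) auto
  also have "sum g (Op_a ` S \<union> Op_b ` S) = sum g (Op_a ` S) + sum g (Op_b ` S)"
    using fin by (intro sum.union_disjoint) auto
  finally show ?thesis
    unfolding Collect_admissible S_def[symmetric] by (simp add: a b c)
qed

subsection \<open>One time-step\<close>

lemma sum_list_map_fst_snd_const:
  fixes f :: "'a \<Rightarrow> real"
  shows "(\<Sum>e\<leftarrow>map (\<lambda>w. (v, w)) ws. f (fst e) + f (snd e)) = real (length ws) * f v + (\<Sum>w\<leftarrow>ws. f w)"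
    and "(\<Sum>e\<leftarrow>map (\<lambda>w. (w, v)) ws. f (fst e) + f (snd e)) = real (length ws) * f v + (\<Sum>w\<leftarrow>ws. f w)"
  by (induction ws) (simp_all add: algebra_simps)

lemma sum_list_zip:
  fixes f :: "'a \<Rightarrow> real"
  shows "length vs = length ws \<Longrightarrow>
    (\<Sum>e\<leftarrow>zip vs ws. f (fst e) + f (snd e)) = (\<Sum>v\<leftarrow>vs. f v) + (\<Sum>w\<leftarrow>ws. f w)"
  by (induction vs ws rule: list_induct2) simp_all

abbreviation exp_depth :: "(nat \<Rightarrow> nat) \<Rightarrow> nat \<Rightarrow> real" where
  "exp_depth D \<equiv> \<lambda>v. exp (real (D v))"

text \<open>Each sampled vertex gains one incidence. A new vertex has \<open>x\<close> incidences
  and vertex weight \<open>\<gamma>\<close>, and being one deeper than \<open>hd ws\<close> costs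
  the factor \<open>exp 1\<close>.\<close>

lemma weight_perform:
  assumes "fin_digraph G" "admissible x G d" "x \<ge> 1"
  shows "weight \<gamma> (exp_depth (perform_depth d G D)) (perform d G) = weight \<gamma> (exp_depth D) G +
    (case d of
       Op_a ws \<Rightarrow> (\<Sum>w\<leftarrow>ws. exp (real (D w))) + (real x + \<gamma>) * exp 1 * exp (real (D (hd ws)))
     | Op_b ws \<Rightarrow> (\<Sum>w\<leftarrow>ws. exp (real (D w))) + (real x + \<gamma>) * exp 1 * exp (real (D (hd ws)))
     | Op_c vs ws \<Rightarrow> (\<Sum>w\<leftarrow>vs. exp (real (D w))) + (\<Sum>w\<leftarrow>ws. exp (real (D w))))"
proof -
  interpret fin_digraph G by fact
  let ?v = "fresh_label (verts G)"
  let ?H = "G\<lparr>verts := insert ?v (verts G)\<rparr>"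
  let ?D = "perform_depth d G D"
  have v: "?v \<notin> verts G"
    by (rule fresh_label_notin) simp
  \<comment> \<open>Only a label outside the old vertex set is updated, so the weight of the old
    graph and the sums over samples keep their values.\<close>
  then have D: "?D w = D w" if "w \<in> verts G" for w
    using that by (cases d) auto
  have eq: "weight \<gamma> (exp_depth ?D) G = weight \<gamma> (exp_depth D) G"
    by (rule weight_cong) (auto simp: D wf_digraph_axioms)
  have sum: "(\<Sum>w\<leftarrow>ws. exp (real (?D w))) = (\<Sum>w\<leftarrow>ws. exp (real (D w)))"
    if "set ws \<subseteq> verts G" for ws
    using that by (auto simp: D subset_eq intro!: arg_cong[of _ _ sum_list])
  have H: "weight \<gamma> (exp_depth ?D) ?H = weight \<gamma> (exp_depth D) G + \<gamma> * exp (real (?D ?v))"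
    unfolding eq[symmetric] by (rule weight_insert_vertex) (auto simp: v)
  have fin: "finite (arcs ?H)" by simp
  show ?thesis
  proof (cases d)
    case (Op_a ws)
    with assms have ws: "set ws \<subseteq> verts G" "length ws = x" by auto
    have "weight \<gamma> (exp_depth ?D) (perform d G)
        = weight \<gamma> (exp_depth ?D) ?H + (real x * exp (real (?D ?v)) + (\<Sum>w\<leftarrow>ws. exp (real (?D w))))"
      using weight_fold_add_edge[OF fin, of \<gamma> "exp_depth ?D" "map (\<lambda>w. (?v, w)) ws"]
        sum_list_map_fst_snd_const(1)[where f = "exp_depth ?D" and v = ?v and ws = ws] ws(2)
      by (simp only: Op_a perform.simps Let_def)
    also note H
    also note sum[OF ws(1)]
    also have "exp (real (?D ?v)) = exp 1 * exp (real (D (hd ws)))"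
      by (simp add: Op_a exp_add)
    finally show ?thesis
      by (simp add: Op_a algebra_simps del: perform_depth.simps)
  next
    case (Op_b ws)
    with assms have ws: "set ws \<subseteq> verts G" "length ws = x" by auto
    have "weight \<gamma> (exp_depth ?D) (perform d G)
        = weight \<gamma> (exp_depth ?D) ?H + (real x * exp (real (?D ?v)) + (\<Sum>w\<leftarrow>ws. exp (real (?D w))))"
      using weight_fold_add_edge[OF fin, of \<gamma> "exp_depth ?D" "map (\<lambda>w. (w, ?v)) ws"]
        sum_list_map_fst_snd_const(2)[where f = "exp_depth ?D" and v = ?v and ws = ws] ws(2)
      by (simp only: Op_b perform.simps Let_def)
    also note H
    also note sum[OF ws(1)]
    also have "exp (real (?D ?v)) = exp 1 * exp (real (D (hd ws)))"
      by (simp add: Op_b exp_add)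
    finally show ?thesis
      by (simp add: Op_b algebra_simps del: perform_depth.simps)
  next
    case (Op_c vs ws)
    with assms have "length vs = length ws" by auto
    then show ?thesis
      using weight_fold_add_edge[OF finite_arcs] sum_list_zip by (simp add: Op_c)
  qed
qed

text \<open>One draw has expected \<open>f\<close> at most \<open>B = W * z\<close>. Operations (a)
  and (b) then lead to at most \<open>R = W + x * B + \<kappa> * B\<close>, and (c) to
  \<open>W + 2 * x * B\<close>, which is no larger as \<open>x \<le> \<kappa>\<close>. So
  \<open>R\<close> bounds any mixture of the three.\<close>

lemma expected_weight_perform:
  assumes G: "fin_digraph G" and x: "x \<ge> 1"
    and p: "p\<^sub>a \<ge> 0" "p\<^sub>b \<ge> 0" "p\<^sub>c \<ge> 0" "p\<^sub>a + p\<^sub>b + p\<^sub>c = 1"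
    and ab: "\<alpha> \<ge> 0" "\<beta> \<ge> 0"
    and z: "inverse (real (card (arcs G)) + \<alpha> * real (card (verts G))) \<le> z"
      "inverse (real (card (arcs G)) + \<beta> * real (card (verts G))) \<le> z"
  shows "(\<Sum>d | admissible x G d. choice_prob p\<^sub>a p\<^sub>b p\<^sub>c \<alpha> \<beta> G x d *
      weight (\<alpha> + \<beta>) (exp_depth (perform_depth d G D)) (perform d G))
    \<le> (1 + (real x + exp 1 * (real x + \<alpha> + \<beta>)) * z) * weight (\<alpha> + \<beta>) (exp_depth D) G"
proof -
  interpret fin_digraph G by fact
  define S where "S = {ws. set ws \<subseteq> verts G \<and> length ws = x}"
  define f where "f = exp_depth D"
  define W where "W = weight (\<alpha> + \<beta>) f G"
  define B where "B = W * z"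
  define \<kappa> where "\<kappa> = (real x + (\<alpha> + \<beta>)) * exp 1"
  interpret I: subprobability_on "verts G" "rho_in \<alpha> G"
    by unfold_locales (auto simp: rho_nonneg ab sum_rho_le_1 G)
  interpret O: subprobability_on "verts G" "rho_out \<beta> G"
    by unfold_locales (auto simp: rho_nonneg ab sum_rho_le_1 G)
  have f: "f v \<ge> 0" for v by (simp add: f_def)
  have IB: "(\<Sum>v\<in>verts G. rho_in \<alpha> G v * f v) \<le> B"
    and OB: "(\<Sum>v\<in>verts G. rho_out \<beta> G v * f v) \<le> B"
    unfolding B_def W_def using ab z f G by (auto intro!: sum_rho_le_weight)
  have W: "W \<ge> 0"
    unfolding W_def using f ab by (simp add: weight_nonneg)
  have "inverse (real (card (arcs G)) + \<alpha> * real (card (verts G))) \<ge> 0"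
    using ab by simp
  then have z0: "z \<ge> 0" using z by linarith
  then have B: "B \<ge> 0" unfolding B_def using W by simp
  have \<kappa>: "\<kappa> \<ge> real x"
  proof -
    have "real x * 1 \<le> (real x + (\<alpha> + \<beta>)) * exp 1"
      using ab by (intro mult_mono) auto
    then show ?thesis by (simp add: \<kappa>_def)
  qed
  define R where "R = W + real x * B + \<kappa> * B"
  let ?w = "\<lambda>d. weight (\<alpha> + \<beta>) (exp_depth (perform_depth d G D)) (perform d G)"
  have wa: "?w (Op_a ws) = W + (\<Sum>w\<leftarrow>ws. f w) + \<kappa> * f (hd ws)"
    and wb: "?w (Op_b ws) = W + (\<Sum>w\<leftarrow>ws. f w) + \<kappa> * f (hd ws)" if "ws \<in> S" for ws
    using that x weight_perform[OF G, of x "Op_a ws" "\<alpha> + \<beta>" D]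
      weight_perform[OF G, of x "Op_b ws" "\<alpha> + \<beta>" D]
    by (simp_all add: S_def W_def f_def \<kappa>_def)
  have wc: "?w (Op_c vs ws) = W + (\<Sum>w\<leftarrow>vs. f w) + (\<Sum>w\<leftarrow>ws. f w)" if "vs \<in> S" "ws \<in> S" for vs ws
    using that x weight_perform[OF G, of x "Op_c vs ws" "\<alpha> + \<beta>" D]
    by (simp add: S_def W_def f_def)
  have a: "(\<Sum>ws\<in>S. choice_prob p\<^sub>a p\<^sub>b p\<^sub>c \<alpha> \<beta> G x (Op_a ws) * ?w (Op_a ws)) \<le> p\<^sub>a * R"
  proof -
    have "(\<Sum>ws\<in>S. choice_prob p\<^sub>a p\<^sub>b p\<^sub>c \<alpha> \<beta> G x (Op_a ws) * ?w (Op_a ws))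
        = p\<^sub>a * I.sampled x (\<lambda>ws. W + (\<Sum>w\<leftarrow>ws. f w) + \<kappa> * f (hd ws))"
      unfolding I.sampled_def S_def[symmetric] sum_distrib_left
      by (intro sum.cong refl, subst wa) (simp_all add: S_def)
    also have "\<dots> \<le> p\<^sub>a * R"
      unfolding R_def using f IB x W \<kappa> p by (intro mult_left_mono I.sampled_le) auto
    finally show ?thesis .
  qed
  have b: "(\<Sum>ws\<in>S. choice_prob p\<^sub>a p\<^sub>b p\<^sub>c \<alpha> \<beta> G x (Op_b ws) * ?w (Op_b ws)) \<le> p\<^sub>b * R"
  proof -
    have "(\<Sum>ws\<in>S. choice_prob p\<^sub>a p\<^sub>b p\<^sub>c \<alpha> \<beta> G x (Op_b ws) * ?w (Op_b ws))
        = p\<^sub>b * O.sampled x (\<lambda>ws. W + (\<Sum>w\<leftarrow>ws. f w) + \<kappa> * f (hd ws))"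
      unfolding O.sampled_def S_def[symmetric] sum_distrib_left
      by (intro sum.cong refl, subst wb) (simp_all add: S_def)
    also have "\<dots> \<le> p\<^sub>b * R"
      unfolding R_def using f OB x W \<kappa> p by (intro mult_left_mono O.sampled_le) auto
    finally show ?thesis .
  qed
  have c: "(\<Sum>vs\<in>S. \<Sum>ws\<in>S. choice_prob p\<^sub>a p\<^sub>b p\<^sub>c \<alpha> \<beta> G x (Op_c vs ws) * ?w (Op_c vs ws)) \<le> p\<^sub>c * R"
  proof -
    have "(\<Sum>vs\<in>S. \<Sum>ws\<in>S. choice_prob p\<^sub>a p\<^sub>b p\<^sub>c \<alpha> \<beta> G x (Op_c vs ws) * ?w (Op_c vs ws))
        = p\<^sub>c * O.sampled x (\<lambda>vs. I.sampled x (\<lambda>ws. W + (\<Sum>w\<leftarrow>vs. f w) + (\<Sum>w\<leftarrow>ws. f w)))"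
      unfolding O.sampled_def I.sampled_def S_def[symmetric] sum_distrib_left
      by (intro sum.cong refl, subst wc) (simp_all add: S_def)
    \<comment> \<open>The heads are averaged with the tails held fixed, whose contribution joins the
      constant term.\<close>
    also have "\<dots> \<le> p\<^sub>c * O.sampled x (\<lambda>vs. (W + real x * B) + (\<Sum>w\<leftarrow>vs. f w))"
    proof (intro mult_left_mono O.sampled_mono p)
      fix vs
      have "0 \<le> W + (\<Sum>w\<leftarrow>vs. f w)"
        using W f by (intro add_nonneg_nonneg sum_list_nonneg) auto
      then show "I.sampled x (\<lambda>ws. W + (\<Sum>w\<leftarrow>vs. f w) + (\<Sum>w\<leftarrow>ws. f w))
          \<le> W + real x * B + (\<Sum>w\<leftarrow>vs. f w)"
        using I.sampled_le[OF f IB x, of "W + (\<Sum>w\<leftarrow>vs. f w)" 0] by simp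
    qed
    also have "\<dots> \<le> p\<^sub>c * (W + real x * B + real x * B)"
      using O.sampled_le[OF f OB x, of "W + real x * B" 0] W B p by (intro mult_left_mono) auto
    also have "\<dots> \<le> p\<^sub>c * R"
      unfolding R_def using \<kappa> B p by (intro mult_left_mono add_mono mult_right_mono) auto
    finally show ?thesis .
  qed
  have "(\<Sum>d | admissible x G d. choice_prob p\<^sub>a p\<^sub>b p\<^sub>c \<alpha> \<beta> G x d * ?w d) \<le> p\<^sub>a * R + p\<^sub>b * R + p\<^sub>c * R"
    unfolding sum_admissible[OF finite_verts] S_def[symmetric] using a b c by (intro add_mono)
  also have "\<dots> = (p\<^sub>a + p\<^sub>b + p\<^sub>c) * R"
    by (simp only: distrib_right)
  also have "\<dots> = (1 + (real x + exp 1 * (real x + \<alpha> + \<beta>)) * z) * W"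
    unfolding p(4) R_def B_def \<kappa>_def by (simp add: algebra_simps)
  finally show ?thesis
    unfolding W_def f_def .
qed

lemma choice_prob_nonneg:
  assumes "p\<^sub>a \<ge> 0" "p\<^sub>b \<ge> 0" "p\<^sub>c \<ge> 0" "\<alpha> \<ge> 0" "\<beta> \<ge> 0"
  shows "choice_prob p\<^sub>a p\<^sub>b p\<^sub>c \<alpha> \<beta> G x d \<ge> 0"
  using assms
  by (cases d) (auto intro!: mult_nonneg_nonneg prod_list_nonneg simp: rho_nonneg)

text \<open>Every operation adds exactly \<open>x\<close> arcs, which makes the normalising
  denominators grow linearly; preserved end pairs keep old walks available.\<close>

lemma perform_graph:
  assumes "fin_digraph G" "admissible x G d"
  shows "fin_digraph (perform d G)" (is ?fin)
    and "card (arcs (perform d G)) = x + card (arcs G)" (is ?card)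
    and "arcs_ends G \<subseteq> arcs_ends (perform d G)" (is ?ends)
proof -
  interpret fin_digraph G by fact
  have wf: "fin_digraph H \<longleftrightarrow> finite (verts H) \<and> finite (arcs H) \<and> arcs_ends H \<subseteq> verts H \<times> verts H"
    for H :: multigraph
    by (auto simp: fin_digraph_def wf_digraph_def fin_digraph_axioms_def arcs_ends_def arc_to_ends_def)
  have "finite (arcs (G\<lparr>verts := V\<rparr>))" for V by simp
  note rules = finite_arcs_fold_add_edge[OF this] arcs_ends_fold_add_edge[OF this]
    card_arcs_fold_add_edge[OF this]
    finite_arcs_fold_add_edge[OF finite_arcs] arcs_ends_fold_add_edge[OF finite_arcs]
    card_arcs_fold_add_edge[OF finite_arcs]
  have ends: "arcs_ends (G\<lparr>verts := V\<rparr>) = arcs_ends G" for V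
    by (simp add: arcs_ends_def arc_to_ends_def)
  have G: "arcs_ends G \<subseteq> verts G \<times> verts G"
    using assms(1) wf by blast
  show ?fin
    unfolding wf using assms(2) G
    by (cases d) (auto simp: Let_def rules ends dest: set_zip_leftD set_zip_rightD)
  show ?card
    using assms(2) by (cases d) (auto simp: Let_def rules)
  show ?ends
    by (cases d) (auto simp: Let_def rules ends)
qed

subsection \<open>The random process\<close>

primrec depth :: "multigraph \<Rightarrow> (nat \<Rightarrow> choice) \<Rightarrow> nat \<Rightarrow> nat \<Rightarrow> nat" where
  "depth G\<^sub>0 c 0 = (\<lambda>_. 0)"
| "depth G\<^sub>0 c (Suc t) = perform_depth (c (Suc t)) (grow G\<^sub>0 c t) (depth G\<^sub>0 c t)"

text \<open>The sizes are quantified existentially instead of being taken from \<open>X\<close>, so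
  this is a property of the first \<open>t\<close> choices alone.\<close>

definition admissible_upto :: "nat \<Rightarrow> nat \<Rightarrow> multigraph \<Rightarrow> (nat \<Rightarrow> choice) \<Rightarrow> nat \<Rightarrow> bool" where
  "admissible_upto l u G\<^sub>0 c t \<longleftrightarrow> (\<forall>i<t. \<exists>x\<in>{l..u}. admissible x (grow G\<^sub>0 c i) (c (Suc i)))"

lemma grow_cong: "(\<And>i. i \<in> {1..t} \<Longrightarrow> c i = d i) \<Longrightarrow> grow G\<^sub>0 c t = grow G\<^sub>0 d t"
  by (induction t) auto

lemma depth_cong: "(\<And>i. i \<in> {1..t} \<Longrightarrow> c i = d i) \<Longrightarrow> depth G\<^sub>0 c t = depth G\<^sub>0 d t"
proof (induction t)
  case (Suc t)
  then show ?case using grow_cong[of t c d] by simp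
qed simp

lemma admissible_upto_cong:
  assumes "\<And>i. i \<in> {1..t} \<Longrightarrow> c i = d i"
  shows "admissible_upto l u G\<^sub>0 c t \<longleftrightarrow> admissible_upto l u G\<^sub>0 d t"
proof -
  have "grow G\<^sub>0 c i = grow G\<^sub>0 d i" "c (Suc i) = d (Suc i)" if "i < t" for i
    using that assms by (auto intro: grow_cong)
  then show ?thesis by (simp add: admissible_upto_def)
qed

lemma admissible_upto_Suc:
  "admissible_upto l u G\<^sub>0 c (Suc t) \<longleftrightarrow>
     admissible_upto l u G\<^sub>0 c t \<and> (\<exists>x\<in>{l..u}. admissible x (grow G\<^sub>0 c t) (c (Suc t)))"
  by (auto simp: admissible_upto_def less_Suc_eq)

lemma grow_fin_digraph:
  assumes "fin_digraph G\<^sub>0" "admissible_upto l u G\<^sub>0 c t"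
  shows "fin_digraph (grow G\<^sub>0 c t) \<and> l * t \<le> card (arcs (grow G\<^sub>0 c t))"
  using assms(2)
proof (induction t)
  case (Suc t)
  then obtain x where x: "x \<ge> l" "admissible x (grow G\<^sub>0 c t) (c (Suc t))"
    and IH: "fin_digraph (grow G\<^sub>0 c t)" "l * t \<le> card (arcs (grow G\<^sub>0 c t))"
    by (auto simp: admissible_upto_Suc)
  then show ?case
    using perform_graph(1,2)[OF IH(1) x(2)] by simp
qed (use assms in simp)

section \<open>Depth as a bound on distances\<close>

lemma relpow_subset_mono:
  fixes R S :: "('a \<times> 'a) set"
  shows "R \<subseteq> S \<Longrightarrow> R ^^ k \<subseteq> S ^^ k"
  by (induction k) (simp_all add: relcomp_mono)

text \<open>The last condition makes a vertex of positive depth an end of some arc, so that its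
  exponential occurs in the weight even for \<open>\<gamma> = 0\<close>.\<close>

definition rooted_depth :: "nat set \<Rightarrow> multigraph \<Rightarrow> (nat \<Rightarrow> nat) \<Rightarrow> bool" where
  "rooted_depth V G D \<longleftrightarrow> (\<forall>v\<in>verts G.
     (\<exists>r\<in>V. \<exists>k\<le>D v. (v, r) \<in> adjacent G ^^ k) \<and> (D v = 0 \<or> v \<in> Domain (adjacent G)))"

text \<open>A new vertex is joined to \<open>hd ws\<close>, which exists as
  \<open>x \<ge> 1\<close>; a walk from there to \<open>V\<close> gets one step longer, as the depth
  does.\<close>

lemma rooted_depth_perform:
  assumes "fin_digraph G" "admissible x G d" "x \<ge> 1" "rooted_depth V G D"
  shows "rooted_depth V (perform d G) (perform_depth d G D)"
  unfolding rooted_depth_def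
proof
  interpret fin_digraph G by fact
  let ?H = "perform d G" and ?E = "perform_depth d G D" and ?v = "fresh_label (verts G)"
  have adj: "adjacent G \<subseteq> adjacent ?H"
    using assms by (intro adjacent_mono perform_graph)
  have rel: "adjacent G ^^ k \<subseteq> adjacent ?H ^^ k" for k
    using adj by (rule relpow_subset_mono)
  have fresh: "?v \<notin> verts G"
    by (rule fresh_label_notin) simp
  fix v assume v: "v \<in> verts ?H"
  show "(\<exists>r\<in>V. \<exists>k\<le>?E v. (v, r) \<in> adjacent ?H ^^ k) \<and> (?E v = 0 \<or> v \<in> Domain (adjacent ?H))"
  proof (cases "v \<in> verts G")
    case True
    then have "?E v = D v"
      using fresh by (cases d) auto
    with True show ?thesis
      using assms(4) adj rel unfolding rooted_depth_def by (metis Domain_mono subset_iff)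
  next
    case False
    then obtain ws where ws: "d = Op_a ws \<or> d = Op_b ws" and vv: "v = ?v"
      using v by (cases d) (auto simp: Let_def)
    then have "ws \<noteq> []" "set ws \<subseteq> verts G"
      using assms(2,3) by auto
    then have w: "hd ws \<in> set ws" "hd ws \<in> verts G"
      by auto
    then obtain r k where r: "r \<in> V" "k \<le> D (hd ws)" "(hd ws, r) \<in> adjacent G ^^ k"
      using assms(4) unfolding rooted_depth_def by blast
    have fin: "finite (arcs (G\<lparr>verts := U\<rparr>))" for U by simp
    have vw: "(v, hd ws) \<in> adjacent ?H"
      using ws w unfolding vv by (auto simp: adjacent_def arcs_ends_fold_add_edge[OF fin] Let_def)
    then have "(v, r) \<in> adjacent ?H ^^ Suc k"
      using r(3) rel by (blast intro: relpow_Suc_I2)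
    moreover have "Suc k \<le> ?E v"
      using r(2) ws vv by auto
    ultimately show ?thesis
      using r(1) vw by blast
  qed
qed

lemma rooted_depth_grow:
  assumes "fin_digraph G\<^sub>0" "admissible_upto l u G\<^sub>0 c t" "l \<ge> 1"
  shows "rooted_depth (verts G\<^sub>0) (grow G\<^sub>0 c t) (depth G\<^sub>0 c t)"
  using assms(2)
proof (induction t)
  case 0
  then show ?case by (auto simp: rooted_depth_def)
next
  case (Suc t)
  then obtain x where "x \<in> {l..u}" "admissible x (grow G\<^sub>0 c t) (c (Suc t))"
    and IH: "admissible_upto l u G\<^sub>0 c t" "rooted_depth (verts G\<^sub>0) (grow G\<^sub>0 c t) (depth G\<^sub>0 c t)"
    by (auto simp: admissible_upto_Suc)
  then show ?case
    using assms grow_fin_digraph[OF assms(1) IH(1)] by (auto intro!: rooted_depth_perform)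
qed

lemma exp_depth_le_weight:
  assumes "fin_digraph G" "v \<in> Domain (adjacent G)" "\<gamma> \<ge> 0"
  shows "exp (real (D v)) \<le> weight \<gamma> (exp_depth D) G"
proof -
  interpret fin_digraph G by fact
  obtain a where a: "a \<in> arcs G" "v = tail G a \<or> v = head G a"
    using assms(2) by (auto simp: adjacent_def arcs_ends_def arc_to_ends_def)
  have "exp (real (D v)) \<le> exp_depth D (tail G a) + exp_depth D (head G a)"
    using a(2) by auto
  also have "\<dots> \<le> (\<Sum>a\<in>arcs G. exp_depth D (tail G a) + exp_depth D (head G a))"
    using a(1) by (intro member_le_sum[where f="\<lambda>a. exp_depth D (tail G a) + exp_depth D (head G a)"]) auto
  also have "\<dots> \<le> weight \<gamma> (exp_depth D) G"
    using assms(3) by (simp add: weight_def sum_nonneg)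
  finally show ?thesis .
qed

text \<open>Walk from each of two vertices to a root and connect the roots inside the initial graph.
  The two walks to roots cause the doubling of \<open>h\<close>, hence the constant
  \<open>4 * exp 1\<close> in the end.\<close>

lemma undirected_diameter_le:
  fixes G\<^sub>0 G :: multigraph
  assumes "fin_digraph G\<^sub>0" "Digraph_Component.connected G\<^sub>0" "wf_digraph G"
    and "arcs_ends G\<^sub>0 \<subseteq> arcs_ends G" "rooted_depth (verts G\<^sub>0) G D"
    and h: "\<And>v. v \<in> verts G \<Longrightarrow> real (D v) \<le> h"
  shows "undirected_diameter G \<le> ereal (2 * h + 2 * real (card (arcs G\<^sub>0)))"
  unfolding undirected_diameter_def
proof (intro SUP_least)
  fix v w assume vw: "v \<in> verts G" "w \<in> verts G"
  obtain r i where r: "r \<in> verts G\<^sub>0" "i \<le> D v" "(v, r) \<in> adjacent G ^^ i"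
    using vw(1) assms(5) unfolding rooted_depth_def by blast
  obtain q j where q: "q \<in> verts G\<^sub>0" "j \<le> D w" "(w, q) \<in> adjacent G ^^ j"
    using vw(2) assms(5) unfolding rooted_depth_def by blast
  obtain k where k: "k \<le> 2 * card (arcs G\<^sub>0)" "(r, q) \<in> adjacent G\<^sub>0 ^^ k"
    using connected_relpow_adjacent[OF assms(1,2) r(1) q(1)] .
  have "(r, q) \<in> adjacent G ^^ k"
    using k(2) relpow_subset_mono[OF adjacent_mono[OF assms(4)], of k] by blast
  then have "(v, w) \<in> adjacent G ^^ (i + k + j)"
    using r(3) relpow_adjacent_sym[OF q(3)] unfolding relpow_add by blast
  then have "undirected_dist G v w \<le> ereal (real (i + k + j))"
    using assms(3) vw(1) by (intro undirected_dist_le)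
  also have "real (i + k + j) \<le> 2 * h + 2 * real (card (arcs G\<^sub>0))"
    using h[OF vw(1)] h[OF vw(2)] r(2) q(2) k(1) by linarith
  finally show "undirected_dist G v w \<le> ereal (2 * h + 2 * real (card (arcs G\<^sub>0)))"
    by simp
qed

lemma arcs_ends_grow:
  assumes "fin_digraph G\<^sub>0" "admissible_upto l u G\<^sub>0 c t"
  shows "arcs_ends G\<^sub>0 \<subseteq> arcs_ends (grow G\<^sub>0 c t)"
  using assms(2)
proof (induction t)
  case (Suc t)
  then obtain x where x: "admissible x (grow G\<^sub>0 c t) (c (Suc t))"
    and IH: "admissible_upto l u G\<^sub>0 c t" "arcs_ends G\<^sub>0 \<subseteq> arcs_ends (grow G\<^sub>0 c t)"
    by (auto simp: admissible_upto_Suc)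
  then show ?case
    using perform_graph(3)[OF _ x] grow_fin_digraph[OF assms(1) IH(1)] by auto
qed simp

section \<open>Integration over discrete histories\<close>

lemma nn_integral_countable_image:
  fixes F :: "'b::countable \<Rightarrow> ennreal"
  assumes Y: "Y \<in> measurable M (count_space UNIV)"
  shows "(\<integral>\<^sup>+\<omega>. F (Y \<omega>) \<partial>M) = (\<integral>\<^sup>+y. F y * emeasure M {\<omega> \<in> space M. Y \<omega> = y} \<partial>count_space UNIV)"
proof -
  have m: "{\<omega> \<in> space M. Y \<omega> = y} \<in> sets M" for y
    using measurable_sets[OF Y, of "{y}"] by (simp add: vimage_def Int_def conj_commute)
  have "(\<integral>\<^sup>+\<omega>. F (Y \<omega>) \<partial>M)
      = (\<integral>\<^sup>+\<omega>. \<integral>\<^sup>+y. F y * indicator {\<omega> \<in> space M. Y \<omega> = y} \<omega> \<partial>count_space UNIV \<partial>M)"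
  proof (intro nn_integral_cong)
    fix \<omega> assume "\<omega> \<in> space M"
    then show "F (Y \<omega>) = (\<integral>\<^sup>+y. F y * indicator {\<omega> \<in> space M. Y \<omega> = y} \<omega> \<partial>count_space UNIV)"
      by (subst nn_integral_count_space'[of "{Y \<omega>}"]) auto
  qed
  also have "\<dots> = (\<integral>\<^sup>+y. \<integral>\<^sup>+\<omega>. F y * indicator {\<omega> \<in> space M. Y \<omega> = y} \<omega> \<partial>M \<partial>count_space UNIV)"
    using m by (intro nn_integral_count_space_nn_integral) auto
  also have "\<dots> = (\<integral>\<^sup>+y. F y * emeasure M {\<omega> \<in> space M. Y \<omega> = y} \<partial>count_space UNIV)"
    using m by (intro nn_integral_cong) (simp add: nn_integral_cmult_indicator)
  finally show ?thesis .
qed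

instance choice :: countable
  by countable_datatype

context directed_scale_free
begin

text \<open>All that the choice at time \<open>t\<close> is conditioned on. A list, unlike a
  function of time, keeps the type countable.\<close>

definition history :: "nat \<Rightarrow> 'w \<Rightarrow> (nat \<times> choice) list \<times> nat" where
  "history t \<omega> = (map (\<lambda>i. (X i \<omega>, c i \<omega>)) [1..<t], X t \<omega>)"

text \<open>Times start at \<open>1\<close> and list positions at \<open>0\<close>, hence the shift;
  beyond the list the value is unspecified.\<close>

definition past_choices :: "(nat \<times> choice) list \<Rightarrow> nat \<Rightarrow> choice" where
  "past_choices hs i = snd (hs ! (i - 1))"

definition past_sizes :: "(nat \<times> choice) list \<times> nat \<Rightarrow> nat \<Rightarrow> nat" where
  "past_sizes k i = (if i - 1 < length (fst k) then fst (fst k ! (i - 1)) else snd k)"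

lemma past_choices_history: "i \<in> {1..<t} \<Longrightarrow> past_choices (fst (history t \<omega>)) i = c i \<omega>"
  by (auto simp: past_choices_def history_def)

text \<open>Translates an atom of \<open>history\<close> into the event on which
  \<open>choice_law\<close> conditions.\<close>

lemma history_eq_iff:
  assumes "t \<ge> 1" "length hs = t - 1"
  shows "history t \<omega> = (hs, x) \<longleftrightarrow>
    (\<forall>i\<in>{1..<t}. X i \<omega> = past_sizes (hs, x) i \<and> c i \<omega> = past_choices hs i) \<and> X t \<omega> = x"
proof -
  have "map (\<lambda>i. (X i \<omega>, c i \<omega>)) [1..<t] = hs \<longleftrightarrow>
      (\<forall>j<t - 1. (X (Suc j) \<omega>, c (Suc j) \<omega>) = hs ! j)"
    using assms by (auto simp: list_eq_iff_nth_eq)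
  also have "\<dots> \<longleftrightarrow> (\<forall>i\<in>{1..<t}. (X i \<omega>, c i \<omega>) = hs ! (i - 1))"
  proof safe
    fix i assume "\<forall>j<t - 1. (X (Suc j) \<omega>, c (Suc j) \<omega>) = hs ! j" "i \<in> {1..<t}"
    then show "(X i \<omega>, c i \<omega>) = hs ! (i - 1)"
      by (cases i) auto
  next
    fix j assume "\<forall>i\<in>{1..<t}. (X i \<omega>, c i \<omega>) = hs ! (i - 1)" "j < t - 1"
    then show "(X (Suc j) \<omega>, c (Suc j) \<omega>) = hs ! j"
      by (drule_tac bspec[of _ _ "Suc j"]) auto
  qed
  also have "\<dots> \<longleftrightarrow>
      (\<forall>i\<in>{1..<t}. X i \<omega> = past_sizes (hs, x) i \<and> c i \<omega> = past_choices hs i)"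
  proof (intro ball_cong refl)
    fix i assume "i \<in> {1..<t}"
    then have "i - 1 < length hs"
      using assms(2) by auto
    then show "(X i \<omega>, c i \<omega>) = hs ! (i - 1) \<longleftrightarrow>
        X i \<omega> = past_sizes (hs, x) i \<and> c i \<omega> = past_choices hs i"
      by (simp add: past_sizes_def past_choices_def prod_eq_iff)
  qed
  finally show ?thesis
    by (simp only: history_def prod.inject)
qed

lemma measurable_eq_X: "t \<ge> 1 \<Longrightarrow> {\<omega> \<in> space M. X t \<omega> = x} \<in> sets M"
  using measurable_sets[OF X_measurable, of t "{x}"] by (simp add: vimage_def Int_def conj_commute)

lemma measurable_eq_c: "t \<ge> 1 \<Longrightarrow> {\<omega> \<in> space M. c t \<omega> = d} \<in> sets M"
  using measurable_sets[OF c_measurable, of t "{d}"] by (simp add: vimage_def Int_def conj_commute)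

lemma measurable_history:
  assumes "t \<ge> 1"
  shows "history t \<in> measurable M (count_space UNIV)"
  unfolding measurable_count_space_eq2_countable
proof (intro conjI ballI)
  fix k
  show "history t -` {k} \<inter> space M \<in> sets M"
  proof (cases "length (fst k) = t - 1")
    case True
    have "{\<omega> \<in> space M. (\<forall>i\<in>{1..<t}. X i \<omega> = past_sizes k i \<and> c i \<omega> = past_choices (fst k) i)
        \<and> X t \<omega> = snd k} \<in> sets M"
    proof (rule sets.sets_Collect_conj[OF measurable_eq_X[OF assms] sets.sets_Collect_finite_All])
      fix i assume "i \<in> {1..<t}"
      then have "i \<ge> 1" by simp
      then show "{\<omega> \<in> space M. X i \<omega> = past_sizes k i \<and> c i \<omega> = past_choices (fst k) i} \<in> sets M"
        by (intro sets.sets_Collect_conj measurable_eq_X measurable_eq_c)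
    qed simp
    also have "{\<omega> \<in> space M. (\<forall>i\<in>{1..<t}. X i \<omega> = past_sizes k i \<and> c i \<omega> = past_choices (fst k) i)
        \<and> X t \<omega> = snd k} = history t -` {k} \<inter> space M"
      using history_eq_iff[OF assms True, of _ "snd k"] by auto
    finally show ?thesis .
  next
    case False
    then have "history t -` {k} = {}"
      by (auto simp: history_def)
    then show ?thesis by simp
  qed
qed auto

text \<open>This is \<open>choice_law\<close> with the conditional probability multiplied out. On a
  null history, about which the law says nothing, both sides vanish.\<close>

lemma emeasure_history_choice:
  assumes "t \<ge> 1"
  shows "emeasure M {\<omega> \<in> space M. (history t \<omega>, c t \<omega>) = (k, d)}
    = ennreal (choice_prob p\<^sub>a p\<^sub>b p\<^sub>c \<alpha> \<beta> (grow G\<^sub>0 (past_choices (fst k)) (t - 1)) (snd k) d)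
      * emeasure M {\<omega> \<in> space M. history t \<omega> = k}"
proof (cases "emeasure M {\<omega> \<in> space M. history t \<omega> = k} = 0")
  case True
  have "{\<omega> \<in> space M. history t \<omega> = k} \<in> sets M"
    using measurable_sets[OF measurable_history[OF assms], of "{k}"]
    by (simp add: vimage_def Int_def conj_commute)
  then have "emeasure M {\<omega> \<in> space M. (history t \<omega>, c t \<omega>) = (k, d)}
      \<le> emeasure M {\<omega> \<in> space M. history t \<omega> = k}"
    by (intro emeasure_mono) auto
  with True show ?thesis by simp
next
  case False
  then have "{\<omega> \<in> space M. history t \<omega> = k} \<noteq> {}" by (metis emeasure_empty)
  then have len: "length (fst k) = t - 1"
    by (auto simp: history_def)
  \<comment> \<open>The law speaks about functions of time, so the past is extended by the present
    choice and size at \<open>t\<close>.\<close>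
  define dd where "dd = (past_choices (fst k))(t := d)"
  define xx where "xx = (past_sizes k)(t := snd k)"
  have grow: "grow G\<^sub>0 dd (t - 1) = grow G\<^sub>0 (past_choices (fst k)) (t - 1)"
    using assms by (intro grow_cong) (auto simp: dd_def)
  have iff: "history t \<omega> = k \<longleftrightarrow> (\<forall>i\<in>{1..<t}. X i \<omega> = xx i \<and> c i \<omega> = dd i) \<and> X t \<omega> = xx t" for \<omega>
    using history_eq_iff[OF assms len, of \<omega> "snd k"] by (auto simp: xx_def dd_def)
  have pos: "\<P>(\<omega> in M. (\<forall>i\<in>{1..<t}. X i \<omega> = xx i \<and> c i \<omega> = dd i) \<and> X t \<omega> = xx t) > 0"
    using False unfolding iff[symmetric] emeasure_eq_measure
    by (simp add: zero_less_measure_iff)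
  have "\<P>(\<omega> in M. c t \<omega> = d \<and> history t \<omega> = k)
      = choice_prob p\<^sub>a p\<^sub>b p\<^sub>c \<alpha> \<beta> (grow G\<^sub>0 (past_choices (fst k)) (t - 1)) (snd k) d
        * \<P>(\<omega> in M. history t \<omega> = k)"
    using choice_law[OF assms pos] pos
    unfolding cond_prob_def iff[symmetric] grow
    by (simp add: dd_def xx_def field_simps)
  then show ?thesis
    unfolding emeasure_eq_measure
    by (simp add: ennreal_mult'' conj_commute)
qed

text \<open>Tower property: condition on the history and average over the choice at time
  \<open>t\<close>. By the assumption on \<open>F\<close>, the choices decoded from the history can
  replace the actual ones.\<close>

lemma nn_integral_choice:
  fixes F :: "nat \<Rightarrow> (nat \<Rightarrow> choice) \<Rightarrow> ennreal"
  assumes t: "t \<ge> 1"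
    and dep: "\<And>x cs ds. (\<And>i. i \<in> {1..t} \<Longrightarrow> cs i = ds i) \<Longrightarrow> F x cs = F x ds"
  shows "(\<integral>\<^sup>+\<omega>. F (X t \<omega>) (\<lambda>i. c i \<omega>) \<partial>M)
    = (\<integral>\<^sup>+\<omega>. (\<integral>\<^sup>+d. ennreal (choice_prob p\<^sub>a p\<^sub>b p\<^sub>c \<alpha> \<beta> (grow G\<^sub>0 (\<lambda>i. c i \<omega>) (t - 1)) (X t \<omega>) d)
        * F (X t \<omega>) ((\<lambda>i. c i \<omega>)(t := d)) \<partial>count_space UNIV) \<partial>M)"
proof -
  define F' where "F' k d = F (snd k) ((past_choices (fst k))(t := d))" for k d
  define Q where "Q k d = ennreal (choice_prob p\<^sub>a p\<^sub>b p\<^sub>c \<alpha> \<beta>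
    (grow G\<^sub>0 (past_choices (fst k)) (t - 1)) (snd k) d)" for k d
  let ?P = "\<lambda>k. emeasure M {\<omega> \<in> space M. history t \<omega> = k}"
  have snd: "snd (history t \<omega>) = X t \<omega>" for \<omega>
    by (simp add: history_def)
  have F': "F' (history t \<omega>) d = F (X t \<omega>) ((\<lambda>i. c i \<omega>)(t := d))" for \<omega> d
    unfolding F'_def snd by (intro dep) (auto simp: past_choices_history)
  have Q: "Q (history t \<omega>) d = ennreal (choice_prob p\<^sub>a p\<^sub>b p\<^sub>c \<alpha> \<beta>
      (grow G\<^sub>0 (\<lambda>i. c i \<omega>) (t - 1)) (X t \<omega>) d)" for \<omega> d
  proof -
    have "grow G\<^sub>0 (past_choices (fst (history t \<omega>))) (t - 1) = grow G\<^sub>0 (\<lambda>i. c i \<omega>) (t - 1)"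
      using t by (intro grow_cong past_choices_history) auto
    then show ?thesis by (simp add: Q_def snd)
  qed
  have meas: "(\<lambda>\<omega>. (history t \<omega>, c t \<omega>)) \<in> measurable M (count_space UNIV)"
    unfolding measurable_count_space_eq2_countable
  proof (intro conjI ballI)
    fix y
    have "history t -` {fst y} \<inter> space M \<inter> (c t -` {snd y} \<inter> space M) \<in> sets M"
      using t by (intro sets.Int measurable_sets[OF measurable_history] measurable_sets[OF c_measurable]) auto
    also have "history t -` {fst y} \<inter> space M \<inter> (c t -` {snd y} \<inter> space M)
        = (\<lambda>\<omega>. (history t \<omega>, c t \<omega>)) -` {y} \<inter> space M"
      by (cases y) auto
    finally show "(\<lambda>\<omega>. (history t \<omega>, c t \<omega>)) -` {y} \<inter> space M \<in> sets M" .
  qed auto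
  have upd: "(\<lambda>i. c i \<omega>)(t := c t \<omega>) = (\<lambda>i. c i \<omega>)" for \<omega>
    by auto
  have "(\<integral>\<^sup>+\<omega>. F (X t \<omega>) (\<lambda>i. c i \<omega>) \<partial>M)
      = (\<integral>\<^sup>+\<omega>. case_prod F' (history t \<omega>, c t \<omega>) \<partial>M)"
    by (simp add: F' upd)
  also have "\<dots> = (\<integral>\<^sup>+y. case_prod F' y * emeasure M {\<omega> \<in> space M. (history t \<omega>, c t \<omega>) = y}
      \<partial>count_space UNIV)"
    by (rule nn_integral_countable_image[OF meas])
  also have "\<dots> = (\<integral>\<^sup>+k. \<integral>\<^sup>+d. F' k d * emeasure M {\<omega> \<in> space M. (history t \<omega>, c t \<omega>) = (k, d)}
      \<partial>count_space UNIV \<partial>count_space UNIV)"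
    by (subst nn_integral_fst_count_space[symmetric]) simp
  also have "\<dots> = (\<integral>\<^sup>+k. (\<integral>\<^sup>+d. Q k d * F' k d \<partial>count_space UNIV) * ?P k \<partial>count_space UNIV)"
    unfolding emeasure_history_choice[OF t] Q_def
    by (subst nn_integral_multc[symmetric]) (simp_all add: mult_ac)
  also have "\<dots> = (\<integral>\<^sup>+\<omega>. (\<integral>\<^sup>+d. Q (history t \<omega>) d * F' (history t \<omega>) d \<partial>count_space UNIV) \<partial>M)"
    by (rule nn_integral_countable_image[OF measurable_history[OF t], symmetric])
  finally show ?thesis
    unfolding Q F' .
qed

text \<open>The quantity factors through the discrete variable
  \<open>history (Suc t)\<close>.\<close>

lemma measurable_choices:
  assumes "\<And>cs ds. (\<And>i. i \<in> {1..t} \<Longrightarrow> cs i = ds i) \<Longrightarrow> F cs = F ds"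
  shows "(\<lambda>\<omega>. F (\<lambda>i. c i \<omega>)) \<in> measurable M (count_space UNIV)"
proof -
  have "(\<lambda>\<omega>. F (past_choices (fst (history (Suc t) \<omega>)))) \<in> measurable M (count_space UNIV)"
    by (rule measurable_compose[OF measurable_history]) auto
  moreover have "F (past_choices (fst (history (Suc t) \<omega>))) = F (\<lambda>i. c i \<omega>)" for \<omega>
    by (intro assms past_choices_history) auto
  ultimately show ?thesis by simp
qed

end

subsection \<open>The tail bound\<close>

lemma admissible_unique: "admissible x G d \<Longrightarrow> admissible y G d \<Longrightarrow> x = y"
  by (cases d) auto

text \<open>The sum is a natural number divided by \<open>s\<close>: either it is at least
  \<open>1 / s\<close>, or it is \<open>0\<close> and so is its \<open>inverse\<close>.\<close>

lemma inverse_degree_sum_le: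
  fixes m n r s :: nat
  assumes "s \<ge> 1"
  shows "inverse (real m + real r / real s * real n) \<le> real s"
proof -
  define N where "N = s * m + r * n"
  have eq: "inverse (real m + real r / real s * real n) = real s / real N"
    using assms by (simp add: N_def field_simps)
  show ?thesis
  proof (cases "N = 0")
    case True
    then show ?thesis unfolding eq by simp
  next
    case False
    then have "real s / real N \<le> real s / 1"
      by (intro divide_left_mono) auto
    then show ?thesis unfolding eq by simp
  qed
qed

text \<open>
  The denominators of \<open>\<alpha>\<close> and \<open>\<beta>\<close> matter only for the first step: they bound the reciprocal of a
  positive normalising denominator of the initial graph by \<open>s\<close>.
\<close>

locale bounded_directed_scale_free = directed_scale_free +
  fixes r q s l u :: nat
  assumes p_nonneg: "p\<^sub>a \<ge> 0" "p\<^sub>b \<ge> 0" "p\<^sub>c \<ge> 0" and p_sum: "p\<^sub>a + p\<^sub>b + p\<^sub>c = 1"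
    and s: "s \<ge> 1" and \<alpha>: "\<alpha> = real r / real s" and \<beta>: "\<beta> = real q / real s"
    and l: "l \<ge> 1" and u: "u \<ge> 1"
    and X_bounds: "AE \<omega> in M. \<forall>t\<ge>1. l \<le> X t \<omega> \<and> X t \<omega> \<le> u"
begin

lemma \<alpha>_nonneg: "\<alpha> \<ge> 0" and \<beta>_nonneg: "\<beta> \<ge> 0"
  by (simp_all add: \<alpha> \<beta>)

text \<open>Bounds the reciprocals of both normalising denominators: at time \<open>t\<close> there
  are at least \<open>l * t\<close> arcs, and at time \<open>0\<close> the common denominator
  \<open>s\<close> of the parameters helps.\<close>

definition \<zeta> :: "nat \<Rightarrow> real" where
  "\<zeta> t = (if t = 0 then real s else inverse (real l * real t))"

text \<open>The coefficient of \<open>z\<close> in \<open>expected_weight_perform\<close>, with the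
  sample size replaced by its bound \<open>u\<close>.\<close>

definition rate :: real where
  "rate = real u + exp 1 * (real u + \<alpha> + \<beta>)"

lemma rate_nonneg: "rate \<ge> 0"
  using \<alpha>_nonneg \<beta>_nonneg by (simp add: rate_def)

lemma \<zeta>_nonneg: "\<zeta> t \<ge> 0"
  by (simp add: \<zeta>_def)

text \<open>The value \<open>0\<close> off the admissible histories makes the one-step estimate true
  for every history; by \<open>AE_admissible_upto\<close> this changes the weight only on a null
  set.\<close>

definition V :: "nat \<Rightarrow> (nat \<Rightarrow> choice) \<Rightarrow> ennreal" where
  "V t cs = (if admissible_upto l u G\<^sub>0 cs t
     then ennreal (weight (\<alpha> + \<beta>) (exp_depth (depth G\<^sub>0 cs t)) (grow G\<^sub>0 cs t)) else 0)"

lemma V_cong: "(\<And>i. i \<in> {1..t} \<Longrightarrow> cs i = ds i) \<Longrightarrow> V t cs = V t ds"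
  unfolding V_def using grow_cong[of t cs ds] depth_cong[of t cs ds] admissible_upto_cong[of t cs ds]
  by simp

lemma measurable_V: "(\<lambda>\<omega>. V t (\<lambda>i. c i \<omega>)) \<in> borel_measurable M"
  by (rule measurable_compose[OF measurable_choices[of t]]) (auto intro: V_cong)

lemma inverse_denominator_le:
  assumes "admissible_upto l u G\<^sub>0 cs t" "\<delta> \<in> {\<alpha>, \<beta>}"
  shows "inverse (real (card (arcs (grow G\<^sub>0 cs t))) + \<delta> * real (card (verts (grow G\<^sub>0 cs t)))) \<le> \<zeta> t"
proof (cases "t = 0")
  case True
  then show ?thesis
    using inverse_degree_sum_le[OF s] assms(2) by (auto simp: \<zeta>_def \<alpha> \<beta>)
next
  case False
  have "real l * real t \<le> real (card (arcs (grow G\<^sub>0 cs t)))"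
    using grow_fin_digraph[OF finite_initial assms(1)] by (metis of_nat_le_iff of_nat_mult)
  moreover have "0 \<le> \<delta> * real (card (verts (grow G\<^sub>0 cs t)))"
    using assms(2) \<alpha>_nonneg \<beta>_nonneg by auto
  ultimately have "inverse (real (card (arcs (grow G\<^sub>0 cs t))) + \<delta> * real (card (verts (grow G\<^sub>0 cs t))))
      \<le> inverse (real l * real t)"
    using False l by (intro le_imp_inverse_le) auto
  then show ?thesis
    using False by (simp add: \<zeta>_def)
qed

lemma expected_V_step:
  "(\<integral>\<^sup>+d. ennreal (choice_prob p\<^sub>a p\<^sub>b p\<^sub>c \<alpha> \<beta> (grow G\<^sub>0 cs t) x d)
      * V (Suc t) (cs(Suc t := d)) \<partial>count_space UNIV) \<le> ennreal (1 + rate * \<zeta> t) * V t cs"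
proof -
  let ?G = "grow G\<^sub>0 cs t" and ?D = "depth G\<^sub>0 cs t"
  let ?cp = "choice_prob p\<^sub>a p\<^sub>b p\<^sub>c \<alpha> \<beta> ?G x"
  let ?w = "\<lambda>d. weight (\<alpha> + \<beta>) (exp_depth (perform_depth d ?G ?D)) (perform d ?G)"
  have upd: "grow G\<^sub>0 (cs(Suc t := d)) t = ?G" "depth G\<^sub>0 (cs(Suc t := d)) t = ?D"
    "admissible_upto l u G\<^sub>0 (cs(Suc t := d)) t \<longleftrightarrow> admissible_upto l u G\<^sub>0 cs t" for d
    by (intro grow_cong depth_cong admissible_upto_cong; auto)+
  have V_Suc: "V (Suc t) (cs(Suc t := d)) =
      (if admissible_upto l u G\<^sub>0 cs t \<and> (\<exists>y\<in>{l..u}. admissible y ?G d) then ennreal (?w d) else 0)" for d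
    by (auto simp: V_def admissible_upto_Suc upd)
  show ?thesis
  proof (cases "admissible_upto l u G\<^sub>0 cs t \<and> x \<in> {l..u}")
    case True
    then have adm: "admissible_upto l u G\<^sub>0 cs t" and x: "x \<ge> 1" "x \<le> u"
      using l by auto
    have G: "fin_digraph ?G"
      using grow_fin_digraph[OF finite_initial adm] by blast
    then interpret G: fin_digraph ?G .
    have w: "?w d \<ge> 0" for d
      using \<alpha>_nonneg \<beta>_nonneg by (intro weight_nonneg) auto
    have cp: "?cp d \<ge> 0" for d
      by (intro choice_prob_nonneg p_nonneg \<alpha>_nonneg \<beta>_nonneg)
    have "(\<integral>\<^sup>+d. ennreal (?cp d) * V (Suc t) (cs(Suc t := d)) \<partial>count_space UNIV)
        = (\<Sum>d | admissible x ?G d. ennreal (?cp d) * V (Suc t) (cs(Suc t := d)))"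
      by (intro nn_integral_count_space' finite_admissible)
        (auto simp: choice_prob_not_admissible)
    also have "\<dots> = (\<Sum>d | admissible x ?G d. ennreal (?cp d * ?w d))"
      using True by (intro sum.cong) (auto simp: V_Suc ennreal_mult cp w)
    also have "\<dots> = ennreal (\<Sum>d | admissible x ?G d. ?cp d * ?w d)"
      using cp w by (intro sum_ennreal) auto
    also have "\<dots> \<le> ennreal ((1 + (real x + exp 1 * (real x + \<alpha> + \<beta>)) * \<zeta> t)
        * weight (\<alpha> + \<beta>) (exp_depth ?D) ?G)"
      by (intro ennreal_leI expected_weight_perform G x p_nonneg p_sum \<alpha>_nonneg \<beta>_nonneg
          inverse_denominator_le[OF adm]) auto
    also have "\<dots> \<le> ennreal ((1 + rate * \<zeta> t) * weight (\<alpha> + \<beta>) (exp_depth ?D) ?G)"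
      unfolding rate_def using x \<alpha>_nonneg \<beta>_nonneg
      by (intro ennreal_leI mult_right_mono add_mono mult_left_mono weight_nonneg \<zeta>_nonneg) auto
    also have "\<dots> = ennreal (1 + rate * \<zeta> t) * V t cs"
      using adm \<alpha>_nonneg \<beta>_nonneg rate_nonneg \<zeta>_nonneg
      by (simp add: V_def ennreal_mult weight_nonneg)
    finally show ?thesis .
  next
    case False
    \<comment> \<open>A nonzero product needs an admissible past and \<open>d\<close> admissible
      both for \<open>x\<close> and for a size in range. By \<open>admissible_unique\<close> that
      size is \<open>x\<close>, against the case assumption.\<close>
    have "ennreal (?cp d) * V (Suc t) (cs(Suc t := d)) = 0" for d
    proof (cases "admissible x ?G d")
      case True
      then have "\<not> (admissible_upto l u G\<^sub>0 cs t \<and> (\<exists>y\<in>{l..u}. admissible y ?G d))"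
        using False admissible_unique by blast
      then show ?thesis
        unfolding V_Suc by (simp only: if_False mult_zero_right)
    qed (simp add: choice_prob_not_admissible)
    note zero = this
    show ?thesis by (simp only: zero) simp
  qed
qed

text \<open>Iterates \<open>expected_V_step\<close> by the tower property. Initially all depths are
  \<open>0\<close>, so their exponentials are \<open>1\<close>.\<close>

lemma expected_V:
  "(\<integral>\<^sup>+\<omega>. V t (\<lambda>i. c i \<omega>) \<partial>M) \<le> ennreal (weight (\<alpha> + \<beta>) (\<lambda>_. 1) G\<^sub>0 * (\<Prod>i<t. 1 + rate * \<zeta> i))"
proof (induction t)
  case 0
  then show ?case by (simp add: V_def admissible_upto_def emeasure_space_1)
next
  case (Suc t)
  have "(\<integral>\<^sup>+\<omega>. V (Suc t) (\<lambda>i. c i \<omega>) \<partial>M)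
    = (\<integral>\<^sup>+\<omega>. (\<integral>\<^sup>+d. ennreal (choice_prob p\<^sub>a p\<^sub>b p\<^sub>c \<alpha> \<beta> (grow G\<^sub>0 (\<lambda>i. c i \<omega>) t) (X (Suc t) \<omega>) d)
        * V (Suc t) ((\<lambda>i. c i \<omega>)(Suc t := d)) \<partial>count_space UNIV) \<partial>M)"
    by (subst nn_integral_choice[where t = "Suc t" and F = "\<lambda>_. V (Suc t)"]) (simp, rule V_cong, simp_all only: diff_Suc_1)
  also have "\<dots> \<le> (\<integral>\<^sup>+\<omega>. ennreal (1 + rate * \<zeta> t) * V t (\<lambda>i. c i \<omega>) \<partial>M)"
    by (intro nn_integral_mono expected_V_step)
  also have "\<dots> = ennreal (1 + rate * \<zeta> t) * (\<integral>\<^sup>+\<omega>. V t (\<lambda>i. c i \<omega>) \<partial>M)"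
    by (intro nn_integral_cmult measurable_V)
  also have "\<dots> \<le> ennreal (1 + rate * \<zeta> t)
      * ennreal (weight (\<alpha> + \<beta>) (\<lambda>_. 1) G\<^sub>0 * (\<Prod>i<t. 1 + rate * \<zeta> i))"
    by (intro mult_left_mono Suc) auto
  also have "\<dots> = ennreal (weight (\<alpha> + \<beta>) (\<lambda>_. 1) G\<^sub>0 * (\<Prod>i<Suc t. 1 + rate * \<zeta> i))"
    using rate_nonneg \<zeta>_nonneg \<alpha>_nonneg \<beta>_nonneg
    by (subst ennreal_mult[symmetric])
      (auto simp: mult_ac weight_nonneg intro!: mult_nonneg_nonneg prod_nonneg add_nonneg_nonneg)
  finally show ?case .
qed

text \<open>The indicator \<open>F\<close> of an inadmissible choice integrates to \<open>0\<close>
  when that choice is averaged first; the countably many steps are then combined with the bounds on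
  \<open>X\<close>.\<close>

lemma AE_admissible_upto: "AE \<omega> in M. admissible_upto l u G\<^sub>0 (\<lambda>i. c i \<omega>) n"
proof -
  have "AE \<omega> in M. admissible (X (Suc t) \<omega>) (grow G\<^sub>0 (\<lambda>i. c i \<omega>) t) (c (Suc t) \<omega>)" for t
  proof -
    define F :: "nat \<Rightarrow> (nat \<Rightarrow> choice) \<Rightarrow> ennreal" where
      "F x cs = (if admissible x (grow G\<^sub>0 cs t) (cs (Suc t)) then 0 else 1)" for x cs
    have dep: "F x cs = F x ds" if "\<And>i. i \<in> {1..Suc t} \<Longrightarrow> cs i = ds i" for x cs ds
    proof -
      have "grow G\<^sub>0 cs t = grow G\<^sub>0 ds t" "cs (Suc t) = ds (Suc t)"
        using that by (auto intro: grow_cong)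
      then show ?thesis by (simp add: F_def)
    qed
    have upd: "grow G\<^sub>0 (cs(Suc t := d)) t = grow G\<^sub>0 cs t" for cs d
      by (intro grow_cong) auto
    have "(\<integral>\<^sup>+\<omega>. F (X (Suc t) \<omega>) (\<lambda>i. c i \<omega>) \<partial>M) = 0"
    proof (subst nn_integral_choice)
      have "ennreal (choice_prob p\<^sub>a p\<^sub>b p\<^sub>c \<alpha> \<beta> (grow G\<^sub>0 cs t) x d) * F x (cs(Suc t := d)) = 0" for cs x d
        by (simp add: F_def upd choice_prob_not_admissible)
      note zero = this
      show "(\<integral>\<^sup>+\<omega>. (\<integral>\<^sup>+d. ennreal (choice_prob p\<^sub>a p\<^sub>b p\<^sub>c \<alpha> \<beta>
          (grow G\<^sub>0 (\<lambda>i. c i \<omega>) (Suc t - 1)) (X (Suc t) \<omega>) d)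
        * F (X (Suc t) \<omega>) ((\<lambda>i. c i \<omega>)(Suc t := d)) \<partial>count_space UNIV) \<partial>M) = 0"
        by (simp only: diff_Suc_1 zero) simp
    qed (simp, rule dep, simp)
    moreover have "(\<lambda>\<omega>. F (X (Suc t) \<omega>) (\<lambda>i. c i \<omega>)) \<in> borel_measurable M"
    proof (rule measurable_compose_countable[OF _ X_measurable])
      show "(\<lambda>\<omega>. F x (\<lambda>i. c i \<omega>)) \<in> borel_measurable M" for x
        by (rule measurable_compose[OF measurable_choices[of "Suc t"]]) (rule dep, simp_all)
    qed simp
    ultimately have "AE \<omega> in M. F (X (Suc t) \<omega>) (\<lambda>i. c i \<omega>) = 0"
      by (simp add: nn_integral_0_iff_AE)
    then show ?thesis
      by eventually_elim (simp add: F_def split: if_splits)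
  qed
  then have "AE \<omega> in M. \<forall>t. admissible (X (Suc t) \<omega>) (grow G\<^sub>0 (\<lambda>i. c i \<omega>) t) (c (Suc t) \<omega>)"
    by (simp add: AE_all_countable)
  with X_bounds show ?thesis
  proof eventually_elim
    case (elim \<omega>)
    then have "X (Suc t) \<omega> \<in> {l..u}" for t by simp
    with elim show ?case unfolding admissible_upto_def by blast
  qed
qed

lemma sum_\<zeta>_le: "(\<Sum>i<Suc n. \<zeta> i) \<le> real s + (1 + ln (real (Suc n))) / real l"
proof -
  have eq: "(\<Sum>i<Suc n. \<zeta> i) = real s + harm n / real l"
  proof (induction n)
    case 0
    then show ?case by (simp add: \<zeta>_def harm_expand(1))
  next
    case (Suc n)
    have "\<zeta> (Suc n) = inverse (real (Suc n)) / real l"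
      by (simp add: \<zeta>_def divide_inverse mult.commute del: of_nat_Suc)
    with Suc show ?case
      by (simp only: sum.lessThan_Suc[of _ "Suc n"] harm_Suc add_divide_distrib add.assoc)
  qed
  \<comment> \<open>Passing to \<open>Suc n\<close> avoids the logarithm of \<open>0\<close>. The
    harmonic number minus the logarithm decreases from its value \<open>1\<close> at
    \<open>1\<close>.\<close>
  have "harm n \<le> (harm (Suc n) :: real)"
    by (rule harm_mono) simp
  also have "\<dots> \<le> 1 + ln (real (Suc n))"
    using euler_mascheroni_sequence_decreasing[of 1 "Suc n"] by (simp add: harm_expand)
  finally show ?thesis
    unfolding eq by (simp add: divide_right_mono)
qed

lemma prod_rate_le:
  assumes "n \<ge> 1"
  shows "(\<Prod>i<n. 1 + rate * \<zeta> i) \<le> exp (rate * (real s + (1 + ln (real n)) / real l))"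
proof -
  have "(\<Prod>i<n. 1 + rate * \<zeta> i) \<le> (\<Prod>i<n. exp (rate * \<zeta> i))"
    using rate_nonneg \<zeta>_nonneg by (intro prod_mono) (auto intro: add_nonneg_nonneg)
  also have "\<dots> = exp (rate * (\<Sum>i<n. \<zeta> i))"
    by (simp add: exp_sum sum_distrib_left)
  also have "\<dots> \<le> exp (rate * (real s + (1 + ln (real n)) / real l))"
    using sum_\<zeta>_le[of "n - 1"] assms rate_nonneg by (simp add: mult_left_mono)
  finally show ?thesis .
qed

text \<open>Multiplied by \<open>u\<close>, it absorbs the part of the exponent without a logarithm,
  using \<open>u + \<alpha> + \<beta> \<le> (1 + \<alpha> + \<beta>) * u\<close> and
  \<open>1 / l \<le> 1\<close>.\<close>

definition offset :: real where
  "offset = (1 + exp 1) * (1 + \<alpha> + \<beta>) * (real s + 1)"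

text \<open>As \<open>exp 1 \<ge> 2\<close>, the factor \<open>1 + exp 1\<close> is at most
  \<open>2 * exp 1 - 1\<close>. The spare multiple \<open>(u + \<alpha> + \<beta>) / l\<close> of
  the logarithm is at least \<open>1\<close> and leaves the term \<open>- ln n\<close>, which
  becomes the failure probability of order \<open>1 / n\<close>.\<close>

lemma rate_exponent_le:
  assumes "n \<ge> 1"
  shows "rate * (real s + (1 + ln (real n)) / real l)
    \<le> 2 * exp 1 * (real u + \<alpha> + \<beta>) * ln (real n) / real l + offset * real u - ln (real n)"
proof -
  define \<kappa> where "\<kappa> = real u + \<alpha> + \<beta>"
  have e: "exp 1 \<ge> (2::real)"
    using exp_ge_add_one_self[of 1] by simp
  \<comment> \<open>The almost sure bounds at time \<open>1\<close> give a constant statement almost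
    surely, which is true in a probability space.\<close>
  have lu: "l \<le> u"
  proof -
    have "AE \<omega> in M. l \<le> u"
      using X_bounds
    proof eventually_elim
      case (elim \<omega>)
      then have "l \<le> X 1 \<omega>" "X 1 \<omega> \<le> u" by auto
      then show ?case by (rule le_trans)
    qed
    then show ?thesis by (simp add: AE_const)
  qed
  have rate: "rate \<le> (1 + exp 1) * \<kappa>"
    using \<alpha>_nonneg \<beta>_nonneg by (simp add: rate_def \<kappa>_def algebra_simps)
  have \<kappa>u: "\<kappa> \<le> (1 + \<alpha> + \<beta>) * real u"
    using mult_left_mono[of 1 "real u" "\<alpha> + \<beta>"] u \<alpha>_nonneg \<beta>_nonneg
    by (simp add: \<kappa>_def algebra_simps)
  have \<kappa>l: "1 \<le> \<kappa> / real l"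
    using lu l \<alpha>_nonneg \<beta>_nonneg by (simp add: \<kappa>_def)
  have \<kappa>0: "\<kappa> \<ge> 0"
    using \<alpha>_nonneg \<beta>_nonneg by (simp add: \<kappa>_def)
  have ln: "ln (real n) \<ge> 0"
    using assms by simp
  have "rate * (real s + 1 / real l) \<le> ((1 + exp 1) * ((1 + \<alpha> + \<beta>) * real u)) * (real s + 1)"
  proof (rule mult_mono)
    show "rate \<le> (1 + exp 1) * ((1 + \<alpha> + \<beta>) * real u)"
      using rate \<kappa>u by (meson add_nonneg_nonneg exp_ge_zero mult_left_mono order_trans zero_le_one)
    show "real s + 1 / real l \<le> real s + 1"
      using l by simp
  qed (use \<alpha>_nonneg \<beta>_nonneg in auto)
  also have "\<dots> = offset * real u"
    by (simp add: offset_def mult_ac)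
  finally have 1: "rate * (real s + 1 / real l) \<le> offset * real u" .
  have "rate * (ln (real n) / real l) \<le> ((1 + exp 1) * \<kappa>) * (ln (real n) / real l)"
    using rate ln by (intro mult_right_mono) auto
  also have "\<dots> = (1 + exp 1) * (\<kappa> / real l * ln (real n))"
    by simp
  also have "\<dots> \<le> (2 * exp 1 - 1) * (\<kappa> / real l * ln (real n))"
    using e ln \<kappa>0 by (intro mult_right_mono) auto
  also have "\<dots> = 2 * exp 1 * \<kappa> * ln (real n) / real l - \<kappa> / real l * ln (real n)"
    by (simp add: algebra_simps diff_divide_distrib)
  also have "\<dots> \<le> 2 * exp 1 * \<kappa> * ln (real n) / real l - ln (real n)"
    using mult_right_mono[OF \<kappa>l ln] by simp
  finally have 2: "rate * (ln (real n) / real l)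
    \<le> 2 * exp 1 * \<kappa> * ln (real n) / real l - ln (real n)" .
  have "rate * (real s + (1 + ln (real n)) / real l)
      = rate * (real s + 1 / real l) + rate * (ln (real n) / real l)"
    by (simp add: add_divide_distrib algebra_simps)
  with 1 2 show ?thesis
    unfolding \<kappa>_def by linarith
qed

section \<open>From the expected weight to the diameter\<close>

lemma initial_weight_le:
  assumes K: "card (verts G\<^sub>0) + card (arcs G\<^sub>0) \<le> K"
  shows "weight (\<alpha> + \<beta>) (\<lambda>_. 1) G\<^sub>0 \<le> (2 + \<alpha> + \<beta>) * real K"
proof -
  have "weight (\<alpha> + \<beta>) (\<lambda>_. 1) G\<^sub>0 = 2 * real (card (arcs G\<^sub>0)) + (\<alpha> + \<beta>) * real (card (verts G\<^sub>0))"
    by (simp add: weight_def)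
  also have "\<dots> \<le> 2 * real K + (\<alpha> + \<beta>) * real K"
    using K \<alpha>_nonneg \<beta>_nonneg by (intro add_mono mult_left_mono) auto
  finally show ?thesis by (simp add: algebra_simps)
qed

text \<open>Markov's inequality for \<open>V n\<close> bounds the probability of a vertex deeper
  than \<open>h\<close>. Off that event and a null set, \<open>undirected_diameter_le\<close>
  applies.\<close>

lemma prob_diameter_le:
  assumes n: "n \<ge> 1" and K: "card (verts G\<^sub>0) + card (arcs G\<^sub>0) \<le> K"
  shows "\<P>(\<omega> in M. undirected_diameter (grow G\<^sub>0 (\<lambda>t. c t \<omega>) n)
      \<le> ereal (4 * exp 1 * (real u + \<alpha> + \<beta>) * ln (real n) / real l + (2 * offset + 2 * real K) * real u))
    \<ge> 1 - (2 + \<alpha> + \<beta>) * real K / real n"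
    (is "\<P>(\<omega> in M. ?diam \<omega> \<le> ereal ?R) \<ge> _")
proof -
  define h where "h = 2 * exp 1 * (real u + \<alpha> + \<beta>) * ln (real n) / real l + offset * real u"
  \<comment> \<open>With admissibility included, \<open>V n\<close> is the weight on this event and
    hence at least \<open>exp h\<close>.\<close>
  define deep where "deep cs \<longleftrightarrow> admissible_upto l u G\<^sub>0 cs n \<and>
    (\<exists>v\<in>verts (grow G\<^sub>0 cs n). real (depth G\<^sub>0 cs n v) > h)" for cs
  define Good where "Good = {\<omega> \<in> space M. ?diam \<omega> \<le> ereal ?R}"
  define Bad where "Bad = {\<omega> \<in> space M. deep (\<lambda>i. c i \<omega>)}"
  have h0: "h \<ge> 0"
    using \<alpha>_nonneg \<beta>_nonneg n by (simp add: h_def offset_def)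
  have "(\<lambda>\<omega>. deep (\<lambda>i. c i \<omega>)) \<in> measurable M (count_space UNIV)"
  proof (rule measurable_choices[of n])
    fix cs ds :: "nat \<Rightarrow> choice" assume "\<And>i. i \<in> {1..n} \<Longrightarrow> cs i = ds i"
    then show "deep cs \<longleftrightarrow> deep ds"
      using grow_cong[of n cs ds] depth_cong[of n cs ds] admissible_upto_cong[of n cs ds]
      by (simp add: deep_def)
  qed
  then have Bad: "Bad \<in> sets M"
    unfolding Bad_def by (rule predE)
  have "(\<lambda>\<omega>. ?diam \<omega> \<le> ereal ?R) \<in> measurable M (count_space UNIV)"
  proof (rule measurable_choices[of n "\<lambda>cs. undirected_diameter (grow G\<^sub>0 cs n) \<le> ereal ?R"])
    fix cs ds :: "nat \<Rightarrow> choice" assume "\<And>i. i \<in> {1..n} \<Longrightarrow> cs i = ds i"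
    then have "grow G\<^sub>0 cs n = grow G\<^sub>0 ds n" by (rule grow_cong)
    then show "undirected_diameter (grow G\<^sub>0 cs n) \<le> ereal ?R \<longleftrightarrow>
        undirected_diameter (grow G\<^sub>0 ds n) \<le> ereal ?R" by simp
  qed
  then have Good: "Good \<in> sets M"
    unfolding Good_def by (rule predE)
  have "ennreal (exp h) * emeasure M Bad = (\<integral>\<^sup>+\<omega>. ennreal (exp h) * indicator Bad \<omega> \<partial>M)"
    using Bad by (simp add: nn_integral_cmult_indicator)
  also have "\<dots> \<le> (\<integral>\<^sup>+\<omega>. V n (\<lambda>i. c i \<omega>) \<partial>M)"
  proof (intro nn_integral_mono)
    fix \<omega>
    show "ennreal (exp h) * indicator Bad \<omega> \<le> V n (\<lambda>i. c i \<omega>)"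
    proof (cases "\<omega> \<in> Bad")
      case True
      let ?G = "grow G\<^sub>0 (\<lambda>i. c i \<omega>) n" and ?D = "depth G\<^sub>0 (\<lambda>i. c i \<omega>) n"
      obtain v where adm: "admissible_upto l u G\<^sub>0 (\<lambda>i. c i \<omega>) n" and v: "v \<in> verts ?G" "real (?D v) > h"
        using True by (auto simp: Bad_def deep_def)
      \<comment> \<open>Since \<open>h \<ge> 0\<close>, the depth of \<open>v\<close> is positive
        and the last condition of \<open>rooted_depth\<close> applies.\<close>
      have "v \<in> Domain (adjacent ?G)"
        using rooted_depth_grow[OF finite_initial adm l] v h0 by (auto simp: rooted_depth_def)
      then have "exp (real (?D v)) \<le> weight (\<alpha> + \<beta>) (exp_depth ?D) ?G"
        using grow_fin_digraph[OF finite_initial adm] \<alpha>_nonneg \<beta>_nonneg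
        by (intro exp_depth_le_weight) auto
      then have "exp h \<le> weight (\<alpha> + \<beta>) (exp_depth ?D) ?G"
        using v(2) by (meson exp_le_cancel_iff less_imp_le order_trans)
      then show ?thesis
        using True adm by (simp add: V_def ennreal_leI)
    qed simp
  qed
  also have "\<dots> \<le> ennreal (weight (\<alpha> + \<beta>) (\<lambda>_. 1) G\<^sub>0 * (\<Prod>i<n. 1 + rate * \<zeta> i))"
    by (rule expected_V)
  also have "\<dots> \<le> ennreal ((2 + \<alpha> + \<beta>) * real K * exp (h - ln (real n)))"
  proof (intro ennreal_leI mult_mono initial_weight_le[OF K])
    show "(\<Prod>i<n. 1 + rate * \<zeta> i) \<le> exp (h - ln (real n))"
      using prod_rate_le[OF n] rate_exponent_le[OF n] unfolding h_def
      by (meson exp_le_cancel_iff order_trans)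
    show "0 \<le> (\<Prod>i<n. 1 + rate * \<zeta> i)"
      using rate_nonneg \<zeta>_nonneg by (intro prod_nonneg) (auto intro: add_nonneg_nonneg)
  qed (use \<alpha>_nonneg \<beta>_nonneg in auto)
  finally have "exp h * prob Bad \<le> (2 + \<alpha> + \<beta>) * real K * exp (h - ln (real n))"
    using \<alpha>_nonneg \<beta>_nonneg by (simp add: emeasure_eq_measure ennreal_mult[symmetric])
  also have "\<dots> = exp h * ((2 + \<alpha> + \<beta>) * real K / real n)"
    using n by (simp add: exp_diff)
  finally have bad: "prob Bad \<le> (2 + \<alpha> + \<beta>) * real K / real n"
    by (rule mult_left_le_imp_le) simp
  have "AE \<omega> in M. \<omega> \<in> Good \<union> Bad"
    using AE_admissible_upto[of n] AE_space
  proof eventually_elim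
    case (elim \<omega>)
    let ?cs = "\<lambda>i. c i \<omega>"
    show ?case
    proof (cases "deep ?cs")
      case False
      then have "real (depth G\<^sub>0 ?cs n v) \<le> h" if "v \<in> verts (grow G\<^sub>0 ?cs n)" for v
        using that elim by (force simp: deep_def)
      then have "?diam \<omega> \<le> ereal (2 * h + 2 * real (card (arcs G\<^sub>0)))"
        using grow_fin_digraph[OF finite_initial elim(1)] fin_digraph.axioms(1)
        by (intro undirected_diameter_le[OF finite_initial weakly_connected_initial _
              arcs_ends_grow[OF finite_initial elim(1)] rooted_depth_grow[OF finite_initial elim(1) l]]) auto
      \<comment> \<open>As \<open>u \<ge> 1\<close>, the contribution of the initial graph is
        absorbed into a multiple of \<open>u\<close>.\<close>
      also have "2 * h + 2 * real (card (arcs G\<^sub>0)) \<le> ?R"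
      proof -
        have "real (card (arcs G\<^sub>0)) * 1 \<le> real K * real u"
          using K u by (intro mult_mono) auto
        then show ?thesis by (simp add: h_def algebra_simps)
      qed
      finally show ?thesis using elim by (simp add: Good_def)
    qed (use elim in \<open>simp add: Bad_def\<close>)
  qed
  then have "1 = prob (Good \<union> Bad)"
    using Good Bad by (subst prob_eq_1[THEN iffD2]) auto
  also have "\<dots> \<le> prob Good + prob Bad"
    using Good Bad by (rule measure_Un_le)
  finally show ?thesis
    using bad unfolding Good_def by linarith
qed

end

theorem theorem4p2:
  fixes p\<^sub>a p\<^sub>b p\<^sub>c \<alpha> \<beta> :: real
    and r q s K :: nat
    and l u :: "nat \<Rightarrow> nat"
    and M :: "nat \<Rightarrow> 'w measure"
    and G\<^sub>0 :: "nat \<Rightarrow> multigraph"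
    and X :: "nat \<Rightarrow> nat \<Rightarrow> 'w \<Rightarrow> nat"
    and c :: "nat \<Rightarrow> nat \<Rightarrow> 'w \<Rightarrow> choice"
  assumes "p\<^sub>a \<ge> 0" "p\<^sub>b \<ge> 0" "p\<^sub>c \<ge> 0" "p\<^sub>a + p\<^sub>b + p\<^sub>c = 1"
    and "s \<ge> 1" "\<alpha> = real r / real s" "\<beta> = real q / real s"
    and "\<And>n. directed_scale_free (M n) p\<^sub>a p\<^sub>b p\<^sub>c \<alpha> \<beta> (G\<^sub>0 n) (X n) (c n)"
    and "\<And>n. card (verts (G\<^sub>0 n)) + card (arcs (G\<^sub>0 n)) \<le> K"
    and "\<And>n. l n \<ge> 1" "\<And>n. u n \<ge> 1"
    and "\<And>n. AE \<omega> in M n. \<forall>t\<ge>1. l n \<le> X n t \<omega> \<and> X n t \<omega> \<le> u n"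
  shows "\<exists>C::real. (\<lambda>n. \<P>(\<omega> in M n.
      undirected_diameter (grow (G\<^sub>0 n) (\<lambda>t. c n t \<omega>) n)
        \<le> ereal (4 * exp 1 * (real (u n) + \<alpha> + \<beta>) * ln (real n) / real (l n) + C * real (u n))))
    \<longlonglongrightarrow> 1"
proof -
  \<comment> \<open>This is \<open>2 * offset + 2 * K\<close>, spelled out because
    \<open>offset\<close> belongs to a locale that is instantiated for each \<open>n\<close>; only
    \<open>\<alpha>\<close>, \<open>\<beta>\<close>, \<open>s\<close> and \<open>K\<close>
    enter.\<close>
  define C where "C = 2 * ((1 + exp 1) * (1 + \<alpha> + \<beta>) * (real s + 1)) + 2 * real K"
  have model: "bounded_directed_scale_free (M n) p\<^sub>a p\<^sub>b p\<^sub>c \<alpha> \<beta> (G\<^sub>0 n) (X n) (c n) r q s (l n) (u n)" for n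
    unfolding bounded_directed_scale_free_def bounded_directed_scale_free_axioms_def
    using assms by blast
  let ?P = "\<lambda>n. \<P>(\<omega> in M n. undirected_diameter (grow (G\<^sub>0 n) (\<lambda>t. c n t \<omega>) n)
        \<le> ereal (4 * exp 1 * (real (u n) + \<alpha> + \<beta>) * ln (real n) / real (l n) + C * real (u n)))"
  have lower: "1 - (2 + \<alpha> + \<beta>) * real K / real n \<le> ?P n" if "n \<ge> 1" for n
    using bounded_directed_scale_free.prob_diameter_le[OF model that assms(9)]
    by (simp add: C_def bounded_directed_scale_free.offset_def[OF model])
  have upper: "?P n \<le> 1" for n
  proof -
    interpret bounded_directed_scale_free "M n" p\<^sub>a p\<^sub>b p\<^sub>c \<alpha> \<beta> "G\<^sub>0 n" "X n" "c n" r q s "l n" "u n"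
      by (rule model)
    show ?thesis by (rule prob_le_1)
  qed
  have "(\<lambda>n. 1 - (2 + \<alpha> + \<beta>) * real K / real n) \<longlonglongrightarrow> 1 - 0"
    by (intro tendsto_diff tendsto_const lim_const_over_n)
  then have "?P \<longlonglongrightarrow> 1"
    using lower upper
    by (intro tendsto_sandwich[of "\<lambda>n. 1 - (2 + \<alpha> + \<beta>) * real K / real n" ?P sequentially "\<lambda>_. 1" 1]
        eventually_sequentiallyI[of 1]) auto
  then show ?thesis by blast
qed

end
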